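(* Let $n,p$ be positive coprime integers and $\omega\in\widetilde{\mathfrak S}_n$ a dominant $p$-stable affine permutation. Then the complement of $\zeta(\mathcal A(\omega))$ equals the partition $(f_n(\omega),f_{n-1}(\omega),\dots,f_1(\omega))$ (the reversed Pak--Stanley labelling), and the complement of $\eta(\mathcal A(\omega))$ equals $(f^*_n(\omega),\dots,f^*_1(\omega))$ (the reversed dual Pak--Stanley labelling).
   Context: $\widetilde{\mathfrak S}_n$ is the group of bijections $\omega:\mathbb Z\to\mathbb Z$ with $\omega(i+n)=\omega(i)+n$ and $\omega(1)+\dots+\omega(n)=n(n+1)/2$; $\omega$ is dominant if $\omega^{-1}(1)<\dots<\omega^{-1}(n)$ and $p$-stable if $\omega(i)<\omega(i+p)$ for all $i$. The involution $\omega\mapsto\omega^*$ is given by $\omega^*(i)=1-\omega(1-i)$. The Pak--Stanley labelling is $f_i(\omega)=\#\{(a,b)\in[n]\times\mathbb N: a<b<a+p,\ \omega(a)>\omega(b),\ \omega(b)\equiv i\pmod n\}$ for $i\in[n]$, and the dual labelling is $f_i^*(\omega)=f_i(\omega^* )$. A rational Dyck path is a lattice path from $(0,0)$ with $n$ North steps $N=(0,1)$ and $p$ East steps $E=(1,0)$ never going below the line of slope $n/p$ through the origin; $\mathfrak D_{n,p}$ is the set of these. The point $(i,j)$ (or unit square with bottom-right corner $(i,j)$) has label $\ell_{i,j}=jp-in$; each step gets the label of its starting point. $H(x)$ is the set of positive labels of unit squares below $x$ (between $x$ and the diagonal). The zeta map: if $x=x_1\cdots x_{n+p}$, then $\zeta(x)=x_{\sigma(1)}\cdots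 x_{\sigma(n+p)}$ where $\sigma$ orders the steps so that their labels are increasing. The complement of a path $y\in\mathfrak D_{n,p}$ is the partition $(\lambda_1\ge\dots\ge\lambda_n\ge0)$ where $\lambda_j$ is the number of East steps of $y$ preceding its $(n+1-j)$-th North step. For a finite set $H$ of positive integers there is a unique partition whose first-column hook lengths are exactly $H$; $\varphi(x)$ is the partition with first-column hook length set $H(x)$, and $\varphi$ is a bijection from $\mathfrak D_{n,p}$ onto the set of $n,p$-cores (Anderson). The eta map is $\eta(x)=\zeta(\varphi^{-1}(\varphi(x)'))$ where $'$ denotes the conjugate partition. For a partition $\kappa$ let $\alpha(\kappa)=\{\kappa_i+1-i:i\ge1\}$ ($\kappa_i=0$ for $i>\ell(\kappa)$) and $\gamma(\omega)=\{z\in\mathbb Z:\omega(z)\le0\}$; for dominant $p$-stable $\omega$ there is a unique $n,p$-core $\kappa$ with $\alpha(\kappa)=\gamma(\omega)$, and $\mathcal A(\omega)=\varphi^{-1}(\kappa)$. *)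

theory Defs
  imports Main "HOL-Number_Theory.Cong" "HOL-Library.More_List"
begin

subsection \<open>Affine permutations and the Pak--Stanley labelling\<close>

definition affine_perms :: "nat \<Rightarrow> (int \<Rightarrow> int) set" where
  "affine_perms n = {\<omega>. bij \<omega> \<and> (\<forall>i. \<omega> (i + int n) = \<omega> i + int n) \<and>
     (\<Sum>i = 1..int n. \<omega> i) = int n * (int n + 1) div 2}"

definition dominant :: "nat \<Rightarrow> (int \<Rightarrow> int) \<Rightarrow> bool" where
  "dominant n \<omega> \<longleftrightarrow> strict_mono_on {1..int n} (inv \<omega>)"

definition p_stable :: "nat \<Rightarrow> (int \<Rightarrow> int) \<Rightarrow> bool" where
  "p_stable p \<omega> \<longleftrightarrow> (\<forall>i. \<omega> i < \<omega> (i + int p))"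

definition star :: "(int \<Rightarrow> int) \<Rightarrow> int \<Rightarrow> int" where
  "star \<omega> i = 1 - \<omega> (1 - i)"

definition pak_stanley :: "nat \<Rightarrow> nat \<Rightarrow> (int \<Rightarrow> int) \<Rightarrow> nat \<Rightarrow> nat" where
  "pak_stanley n p \<omega> i = card {(a, b). a \<in> {1..int n} \<and> b \<in> \<nat> \<and> a < b \<and> b < a + int p \<and>
     \<omega> a > \<omega> b \<and> [\<omega> b = int i] (mod int n)}"

definition dual_pak_stanley :: "nat \<Rightarrow> nat \<Rightarrow> (int \<Rightarrow> int) \<Rightarrow> nat \<Rightarrow> nat" where
  "dual_pak_stanley n p \<omega> i = pak_stanley n p (star \<omega>) i"

subsection \<open>Partitions and cores\<close>

text \<open>A partition is the list of its positive parts; \<open>part \<kappa> i\<close> is the \<open>i\<close>-th part for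
  \<open>i \<ge> 1\<close>, and is zero beyond the length.\<close>

definition is_partition :: "nat list \<Rightarrow> bool" where
  "is_partition \<kappa> \<longleftrightarrow> sorted_wrt (\<ge>) \<kappa> \<and> (\<forall>k \<in> set \<kappa>. 0 < k)"

definition part :: "nat list \<Rightarrow> nat \<Rightarrow> nat" where
  "part \<kappa> i = nth_default 0 \<kappa> (i - 1)"

definition conjugate :: "nat list \<Rightarrow> nat list" where
  "conjugate \<kappa> = map (\<lambda>j. card {i \<in> {1..length \<kappa>}. j \<le> part \<kappa> i}) [1..<part \<kappa> 1 + 1]"

definition cells :: "nat list \<Rightarrow> (nat \<times> nat) set" where
  "cells \<kappa> = {(i, j). 1 \<le> i \<and> i \<le> length \<kappa> \<and> 1 \<le> j \<and> j \<le> part \<kappa> i}"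

text \<open>Arm plus leg plus one; the subtractions are exact when \<open>(i, j)\<close> is a cell.\<close>

definition hook :: "nat list \<Rightarrow> nat \<Rightarrow> nat \<Rightarrow> nat" where
  "hook \<kappa> i j = (part \<kappa> i - j) + (part (conjugate \<kappa>) j - i) + 1"

definition first_column_hooks :: "nat list \<Rightarrow> nat set" where
  "first_column_hooks \<kappa> = {hook \<kappa> i 1 | i. (i, 1) \<in> cells \<kappa>}"

definition is_core :: "nat \<Rightarrow> nat list \<Rightarrow> bool" where
  "is_core n \<kappa> \<longleftrightarrow> is_partition \<kappa> \<and> (\<forall>(i, j) \<in> cells \<kappa>. hook \<kappa> i j \<noteq> n)"

definition cores :: "nat \<Rightarrow> nat \<Rightarrow> nat list set" where
  "cores n p = {\<kappa>. is_core n \<kappa> \<and> is_core p \<kappa>}"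

subsection \<open>Rational Dyck paths\<close>

datatype step = North | East

definition label :: "nat \<Rightarrow> nat \<Rightarrow> nat \<Rightarrow> nat \<Rightarrow> int" where
  "label n p i j = int j * int p - int i * int n"

text \<open>The label of the point reached after the first \<open>k\<close> steps of \<open>x\<close>, i.e. of the starting
  point of the step \<open>x ! k\<close>.\<close>

definition step_label :: "nat \<Rightarrow> nat \<Rightarrow> step list \<Rightarrow> nat \<Rightarrow> int" where
  "step_label n p x k = label n p (count_list (take k x) East) (count_list (take k x) North)"

text \<open>A point lies weakly above the line of slope \<open>n / p\<close> through the origin iff its label is
  nonnegative.\<close>

definition dyck_paths :: "nat \<Rightarrow> nat \<Rightarrow> step list set" where
  "dyck_paths n p = {x. count_list x North = n \<and> count_list x East = p \<and>
     (\<forall>k \<le> length x. 0 \<le> step_label n p x k)}"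

text \<open>The number of East steps preceding the \<open>j\<close>-th North step, for \<open>1 \<le> j\<close>; this is the
  abscissa of that North step.\<close>

definition easts_before :: "step list \<Rightarrow> nat \<Rightarrow> nat" where
  "easts_before x j =
     count_list (take (filter (\<lambda>k. x ! k = North) [0..<length x] ! (j - 1)) x) East"

text \<open>The unit square with bottom-right corner \<open>(i, j)\<close> lies below \<open>x\<close> iff it is to the right
  of the North step from height \<open>j\<close> to height \<open>j + 1\<close>.\<close>

definition pos_labels :: "nat \<Rightarrow> nat \<Rightarrow> step list \<Rightarrow> int set" where
  "pos_labels n p x = {label n p i j | i j.
     1 \<le> i \<and> i \<le> p \<and> j < n \<and> easts_before x (j + 1) \<le> i - 1 \<and> 0 < label n p i j}"

definition zeta :: "nat \<Rightarrow> nat \<Rightarrow> step list \<Rightarrow> step list" where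
  "zeta n p x = map (\<lambda>k. x ! k) (sort_key (step_label n p x) [0..<length x])"

definition path_complement :: "nat \<Rightarrow> step list \<Rightarrow> nat list" where
  "path_complement n y = map (\<lambda>j. easts_before y (n + 1 - j)) [1..<n + 1]"

definition phi :: "nat \<Rightarrow> nat \<Rightarrow> step list \<Rightarrow> nat list" where
  "phi n p x = (THE \<kappa>. is_partition \<kappa> \<and> int ` first_column_hooks \<kappa> = pos_labels n p x)"

definition phi_inv :: "nat \<Rightarrow> nat \<Rightarrow> nat list \<Rightarrow> step list" where
  "phi_inv n p = inv_into (dyck_paths n p) (phi n p)"

definition eta :: "nat \<Rightarrow> nat \<Rightarrow> step list \<Rightarrow> step list" where
  "eta n p x = zeta n p (phi_inv n p (conjugate (phi n p x)))"

subsection \<open>The Anderson map on affine permutations\<close>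

definition alpha :: "nat list \<Rightarrow> int set" where
  "alpha \<kappa> = {int (part \<kappa> i) + 1 - int i | i. 1 \<le> i}"

definition gamma :: "(int \<Rightarrow> int) \<Rightarrow> int set" where
  "gamma \<omega> = {z. \<omega> z \<le> 0}"

definition anderson :: "nat \<Rightarrow> nat \<Rightarrow> (int \<Rightarrow> int) \<Rightarrow> step list" where
  "anderson n p \<omega> = phi_inv n p (THE \<kappa>. \<kappa> \<in> cores n p \<and> alpha \<kappa> = gamma \<omega>)"

end

theory Submission
  imports Defs
begin

text \<open>Let \<open>\<kappa>\<close> be the core of \<open>\<omega>\<close> and let \<open>m\<close> be the least integer outside \<open>gamma \<omega>\<close>. The complement
  of \<open>gamma \<omega>\<close>, translated by \<open>-m\<close>, is a set \<open>D\<close> of nonnegative integers that contains 0 and is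
  closed under adding \<open>n\<close> and \<open>p\<close>; the positive integers outside \<open>D\<close> are the first-column hook
  lengths of \<open>\<kappa>\<close>. In the Dyck path of \<open>\<kappa>\<close> the North labels are the \<open>v \<in> D\<close> with \<open>v - n \<notin> D\<close>,
  i.e. the numbers \<open>inv \<omega> k - m\<close> for \<open>k = 1, \<dots>, n\<close>, which dominance puts in increasing order. An
  East label \<open>e\<close> satisfies \<open>e - n \<in> D\<close> and \<open>e - n - p \<notin> D\<close>, and there is one in each residue class
  modulo \<open>p\<close>. Hence the number of East labels below the \<open>k\<close>-th North label is the number of \<open>a\<close> with
  \<open>u - p < a < u\<close> and \<open>\<omega> a > n\<close>, where \<open>u = inv \<omega> k\<close>. By dominance \<open>\<omega> a > n\<close> may be replaced by
  \<open>\<omega> a > k\<close> for \<open>a < u\<close>, and this counts the inversions in \<open>f\<^sub>k\<close> up to translation by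
  multiples of \<open>n\<close>. For the dual labelling, both conjugation of \<open>\<kappa>\<close> and \<open>\<omega> \<mapsto> \<omega>\<^sup>*\<close> reflect the
  beta-set: \<open>z\<close> is an element of the old one iff \<open>1 - z\<close> is not an element of the new one.\<close>

section \<open>Decreasing sequences and initial segments\<close>

lemma strict_antimono_range_eq:
  fixes f g :: "nat \<Rightarrow> int"
  assumes f: "\<And>i j. i < j \<Longrightarrow> f j < f i" and g: "\<And>i j. i < j \<Longrightarrow> g j < g i"
    and eq: "range f = range g"
  shows "f k = g k"
proof (induction k rule: less_induct)
  case (less k)
  obtain j where j: "f k = g j" using eq by (metis rangeE rangeI)
  obtain i where i: "g k = f i" using eq by (metis rangeE rangeI)
  \<comment> \<open>If \<open>j < k\<close>, the induction hypothesis gives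
    \<open>f j = g j = f k\<close>, against strictness. The same argument excludes
    \<open>i < k\<close>.\<close>
  have "k \<le> j"
    using less[of j] f[of j k] j by (metis less_irrefl linorder_not_le)
  moreover have "k \<le> i"
    using less[of i] g[of i k] i by (metis less_irrefl linorder_not_le)
  ultimately have "f i \<le> f k" "g j \<le> g k"
    using f[of k i] g[of k j] by (auto simp: le_less)
  then show ?case using i j by linarith
qed

text \<open>Such a set is the interval from 1 to its cardinality. This turns the cardinalities in
  the definition of \<open>conjugate\<close> into inequalities.\<close>

lemma mem_downward_closed_iff:
  fixes S :: "nat set"
  assumes "finite S" and "0 \<notin> S" and down: "\<And>i j. j \<in> S \<Longrightarrow> 1 \<le> i \<Longrightarrow> i \<le> j \<Longrightarrow> i \<in> S"
    and "1 \<le> i"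
  shows "i \<in> S \<longleftrightarrow> i \<le> card S"
proof
  assume "i \<in> S"
  then have "{1..i} \<subseteq> S" using down[of i] by (meson atLeastAtMost_iff subsetI)
  then show "i \<le> card S" using card_mono[OF \<open>finite S\<close>, of "{1..i}"] by simp
next
  assume *: "i \<le> card S"
  show "i \<in> S"
  proof (rule ccontr)
    assume i: "i \<notin> S"
    have "S \<subseteq> {1..<i}"
    proof
      fix j assume j: "j \<in> S"
      have "j < i" using down[OF j \<open>1 \<le> i\<close>] i by (meson not_le)
      then show "j \<in> {1..<i}" using j \<open>0 \<notin> S\<close> by (cases j) auto
    qed
    then have "card S \<le> i - 1" using card_mono[of "{1..<i}" S] by simp
    then show False using * \<open>1 \<le> i\<close> by simp
  qed
qed

subsection \<open>Partitions\<close>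

lemma part_Suc: "part \<kappa> (Suc i) = (if i < length \<kappa> then \<kappa> ! i else 0)"
  by (simp add: part_def nth_default_def)

lemma part_antimono:
  assumes "is_partition \<kappa>" "1 \<le> i" "i \<le> j"
  shows "part \<kappa> j \<le> part \<kappa> i"
  using assms unfolding is_partition_def sorted_wrt_iff_nth_less
  by (cases i; cases j) (auto simp: part_Suc le_less)

lemma part_pos_iff:
  assumes "is_partition \<kappa>" "1 \<le> i"
  shows "0 < part \<kappa> i \<longleftrightarrow> i \<le> length \<kappa>"
  using assms unfolding is_partition_def by (cases i) (auto simp: part_Suc)

lemma partition_eqI:
  assumes 1: "is_partition \<kappa>" and 2: "is_partition \<mu>"
    and eq: "\<And>i. part \<kappa> (Suc i) = part \<mu> (Suc i)"
  shows "\<kappa> = \<mu>"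
proof (rule nth_equalityI)
  have "Suc i \<le> length \<kappa> \<longleftrightarrow> Suc i \<le> length \<mu>" for i
    using part_pos_iff[OF 1, of "Suc i"] part_pos_iff[OF 2, of "Suc i"] eq by simp
  then show len: "length \<kappa> = length \<mu>"
    by (metis le_antisym not_less_eq_eq order_refl)
  show "\<kappa> ! i = \<mu> ! i" if "i < length \<kappa>" for i
    using eq[of i] that len by (simp add: part_Suc)
qed

section \<open>Beta-sets and conjugate partitions\<close>

lemma alpha_eq_range: "alpha \<kappa> = range (\<lambda>i. int (part \<kappa> (Suc i)) - int i)"
proof (rule set_eqI, rule iffI)
  fix z assume "z \<in> alpha \<kappa>"
  then obtain i where "1 \<le> i" "z = int (part \<kappa> i) + 1 - int i"
    unfolding alpha_def by auto
  then show "z \<in> range (\<lambda>i. int (part \<kappa> (Suc i)) - int i)"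
    by (cases i) auto
next
  fix z assume "z \<in> range (\<lambda>i. int (part \<kappa> (Suc i)) - int i)"
  then obtain i where "z = int (part \<kappa> (Suc i)) + 1 - int (Suc i)" by auto
  then show "z \<in> alpha \<kappa>" unfolding alpha_def by fastforce
qed

text \<open>The numbers \<open>part \<kappa> (Suc i) - i\<close> strictly decrease in
  \<open>i\<close>, so the set they form determines the sequence and thereby the parts.\<close>

lemma alpha_inject:
  assumes 1: "is_partition \<kappa>" and 2: "is_partition \<mu>" and eq: "alpha \<kappa> = alpha \<mu>"
  shows "\<kappa> = \<mu>"
proof (rule partition_eqI[OF 1 2])
  have dec: "int (part \<nu> (Suc j)) - int j < int (part \<nu> (Suc i)) - int i"
    if "is_partition \<nu>" "i < j" for \<nu> i j
    using part_antimono[OF that(1), of "Suc i" "Suc j"] that(2) by simp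
  show "part \<kappa> (Suc i) = part \<mu> (Suc i)" for i
    using strict_antimono_range_eq[of "\<lambda>i. int (part \<kappa> (Suc i)) - int i"
        "\<lambda>i. int (part \<mu> (Suc i)) - int i" i] dec[OF 1] dec[OF 2] eq
    unfolding alpha_eq_range by simp
qed

text \<open>Both sides say that row \<open>i\<close> of the diagram meets column \<open>j\<close>:
  the rows reaching column \<open>j\<close> form an initial segment, whose size is the column
  length. All later facts about conjugates rest on this equivalence.\<close>

lemma le_part_conjugate_iff:
  assumes \<kappa>: "is_partition \<kappa>" and "1 \<le> i" "1 \<le> j"
  shows "i \<le> part (conjugate \<kappa>) j \<longleftrightarrow> j \<le> part \<kappa> i"
proof -
  define S where "S = {i \<in> {1..length \<kappa>}. j \<le> part \<kappa> i}"
  have "part (conjugate \<kappa>) j = card S"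
  proof (cases "j \<le> part \<kappa> 1")
    case True
    then show ?thesis using \<open>1 \<le> j\<close>
      by (cases j) (auto simp: conjugate_def part_Suc S_def simp del: upt_Suc)
  next
    case False
    \<comment> \<open>Here \<open>j\<close> exceeds the length of the list
      \<open>conjugate \<kappa>\<close>, so \<open>part\<close> takes its default value 0, and no
      row is long enough.\<close>
    then have "S = {}" using part_antimono[OF \<kappa>, of 1] unfolding S_def by fastforce
    then show ?thesis using False \<open>1 \<le> j\<close>
      by (cases j) (auto simp: conjugate_def part_Suc simp del: upt_Suc)
  qed
  moreover have "i \<in> S \<longleftrightarrow> i \<le> card S"
    by (rule mem_downward_closed_iff)
      (use \<open>1 \<le> i\<close> part_antimono[OF \<kappa>] in \<open>auto simp: S_def intro: order_trans\<close>)
  moreover have "i \<in> S \<longleftrightarrow> j \<le> part \<kappa> i"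
    using part_pos_iff[OF \<kappa> \<open>1 \<le> i\<close>] assms unfolding S_def by auto
  ultimately show ?thesis by simp
qed

lemma is_partition_conjugate:
  assumes \<kappa>: "is_partition \<kappa>"
  shows "is_partition (conjugate \<kappa>)"
proof -
  have nth: "conjugate \<kappa> ! i = part (conjugate \<kappa>) (Suc i)" if "i < length (conjugate \<kappa>)" for i
    using that by (simp add: part_Suc)
  have len: "length (conjugate \<kappa>) = part \<kappa> 1" by (simp add: conjugate_def)
  have "part (conjugate \<kappa>) (Suc j) \<le> part (conjugate \<kappa>) (Suc i)" if "i \<le> j" for i j
  proof (cases "part (conjugate \<kappa>) (Suc j)")
    case (Suc m)
    then have "Suc j \<le> part \<kappa> (Suc m)"
      using le_part_conjugate_iff[OF \<kappa>, of "Suc m" "Suc j"] by simp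
    then have "Suc i \<le> part \<kappa> (Suc m)" using that by simp
    then show ?thesis using le_part_conjugate_iff[OF \<kappa>, of "Suc m" "Suc i"] Suc by simp
  qed simp
  moreover have "0 < part (conjugate \<kappa>) (Suc i)" if "i < part \<kappa> 1" for i
    using le_part_conjugate_iff[OF \<kappa>, of 1 "Suc i"] that by simp
  ultimately show ?thesis
    unfolding is_partition_def sorted_wrt_iff_nth_less
    by (auto simp: in_set_conv_nth nth len)
qed

text \<open>Along the boundary of the diagram, elements and non-elements of the beta-set are the two
  kinds of steps; conjugation reverses the boundary and swaps the kinds.\<close>

lemma alpha_conjugate_compl:
  assumes \<kappa>: "is_partition \<kappa>"
  shows "1 - z \<in> alpha (conjugate \<kappa>) \<longleftrightarrow> z \<notin> alpha \<kappa>"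
proof
  assume "1 - z \<in> alpha (conjugate \<kappa>)"
  then obtain j where j: "1 \<le> j" "z = int j - int (part (conjugate \<kappa>) j)"
    unfolding alpha_def by auto
  show "z \<notin> alpha \<kappa>"
  proof
    assume "z \<in> alpha \<kappa>"
    then obtain i where i: "1 \<le> i" "z = int (part \<kappa> i) + 1 - int i"
      unfolding alpha_def by auto
    \<comment> \<open>Equality would mean that row \<open>i\<close> and column \<open>j\<close> have
      lengths adding up to \<open>i + j - 1\<close>; the sum is at least \<open>i + j\<close> if
      \<open>(i, j)\<close> is a cell and at most \<open>i + j - 2\<close> otherwise.\<close>
    show False using le_part_conjugate_iff[OF \<kappa> i(1) j(1)] i(2) j(2) by linarith
  qed
next
  assume z: "z \<notin> alpha \<kappa>"
  let ?P = "\<lambda>i. int (part \<kappa> (Suc i)) - int i \<le> z"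
  have "?P (length \<kappa> + nat \<bar>z\<bar>)" by (simp add: part_Suc)
  then have P: "?P (LEAST i. ?P i)" by (rule LeastI)
  \<comment> \<open>This is the number of beta-set elements above \<open>z\<close>. Column
    \<open>z + i\<close> turns out to have length exactly \<open>i\<close>, and it is the column
    that produces \<open>1 - z\<close>.\<close>
  define i where "i = (LEAST i. ?P i)"
  have "int (part \<kappa> (Suc i)) - int i \<noteq> z"
    using z unfolding alpha_eq_range by blast
  then have lt: "int (part \<kappa> (Suc i)) - int i < z"
    using P unfolding i_def[symmetric] by simp
  define j where "j = nat (z + int i)"
  have j: "int j = z + int i" "1 \<le> j" "part \<kappa> (Suc i) < j" using lt unfolding j_def by auto
  have "part (conjugate \<kappa>) j < Suc i"
    using le_part_conjugate_iff[OF \<kappa>, of "Suc i" j] j by simp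
  moreover have "i \<le> part (conjugate \<kappa>) j"
  proof (cases i)
    case (Suc k)
    then have "\<not> ?P k" using not_less_Least[of k ?P] unfolding i_def by simp
    then have "j \<le> part \<kappa> (Suc k)" using j Suc by simp
    then show ?thesis using le_part_conjugate_iff[OF \<kappa>, of "Suc k" j] j Suc by simp
  qed simp
  ultimately have "1 - z = int (part (conjugate \<kappa>) j) + 1 - int j" using j by simp
  then show "1 - z \<in> alpha (conjugate \<kappa>)" using j unfolding alpha_def by blast
qed

text \<open>The hook length of a cell is the difference between an element of \<open>alpha \<kappa>\<close> and a
  non-element.\<close>

lemma is_core_if_alpha_closed:
  assumes \<kappa>: "is_partition \<kappa>" and closed: "\<And>z. z \<in> alpha \<kappa> \<Longrightarrow> z - int n \<in> alpha \<kappa>"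
  shows "is_core n \<kappa>"
proof -
  have "hook \<kappa> i j \<noteq> n" if "(i, j) \<in> cells \<kappa>" for i j
  proof
    assume eq: "hook \<kappa> i j = n"
    have ij: "1 \<le> i" "1 \<le> j" "j \<le> part \<kappa> i" using that unfolding cells_def by auto
    then have le: "i \<le> part (conjugate \<kappa>) j" using le_part_conjugate_iff[OF \<kappa>] by blast
    have "int (part \<kappa> i) + 1 - int i \<in> alpha \<kappa>" using ij unfolding alpha_def by blast
    then have "int (part \<kappa> i) + 1 - int i - int n \<in> alpha \<kappa>" by (rule closed)
    moreover have "int (part \<kappa> i) + 1 - int i - int n = int j - int (part (conjugate \<kappa>) j)"
      using eq ij le unfolding hook_def by simp
    moreover have "1 - (int j - int (part (conjugate \<kappa>) j)) \<in> alpha (conjugate \<kappa>)"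
      using ij unfolding alpha_def by force
    ultimately show False using alpha_conjugate_compl[OF \<kappa>] by metis
  qed
  then show ?thesis using \<kappa> unfolding is_core_def by auto
qed

section \<open>Partitions and their first-column hook lengths\<close>

lemma first_column_hooks_eq:
  assumes \<kappa>: "is_partition \<kappa>"
  shows "int ` first_column_hooks \<kappa> =
    (\<lambda>i. int (part \<kappa> (Suc i)) - int i + int (length \<kappa>) - 1) ` {..<length \<kappa>}"
proof -
  have col: "part (conjugate \<kappa>) 1 = length \<kappa>"
  proof (rule antisym)
    show "length \<kappa> \<le> part (conjugate \<kappa>) 1"
      using le_part_conjugate_iff[OF \<kappa>, of "length \<kappa>" 1] part_pos_iff[OF \<kappa>, of "length \<kappa>"]
      by (cases "length \<kappa>") auto
    show "part (conjugate \<kappa>) 1 \<le> length \<kappa>"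
      using le_part_conjugate_iff[OF \<kappa>, of "part (conjugate \<kappa>) 1" 1]
        part_pos_iff[OF \<kappa>, of "part (conjugate \<kappa>) 1"]
      by (cases "part (conjugate \<kappa>) 1") auto
  qed
  have pos: "1 \<le> part \<kappa> (Suc i)" if "i < length \<kappa>" for i
    using part_pos_iff[OF \<kappa>, of "Suc i"] that by simp
  have "first_column_hooks \<kappa> = (\<lambda>i. hook \<kappa> (Suc i) 1) ` {..<length \<kappa>}"
  proof (rule set_eqI, rule iffI)
    fix h assume "h \<in> first_column_hooks \<kappa>"
    then obtain i where i: "h = hook \<kappa> i 1" "1 \<le> i" "i \<le> length \<kappa>"
      unfolding first_column_hooks_def cells_def by auto
    then show "h \<in> (\<lambda>i. hook \<kappa> (Suc i) 1) ` {..<length \<kappa>}"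
      by (intro image_eqI[of _ _ "i - 1"]) auto
  next
    fix h assume "h \<in> (\<lambda>i. hook \<kappa> (Suc i) 1) ` {..<length \<kappa>}"
    then show "h \<in> first_column_hooks \<kappa>"
      unfolding first_column_hooks_def cells_def using pos by fastforce
  qed
  \<comment> \<open>Arm \<open>part \<kappa> (Suc i) - 1\<close>, leg
    \<open>length \<kappa> - Suc i\<close>, plus one: an element of the beta-set translated by
    \<open>length \<kappa> - 1\<close>.\<close>
  moreover have "int (hook \<kappa> (Suc i) 1) = int (part \<kappa> (Suc i)) - int i + int (length \<kappa>) - 1"
    if "i < length \<kappa>" for i
    using pos[OF that] that unfolding hook_def col by simp
  ultimately show ?thesis by (auto simp: image_image)
qed

lemma card_first_column_hooks:
  assumes \<kappa>: "is_partition \<kappa>"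
  shows "card (first_column_hooks \<kappa>) = length \<kappa>"
proof -
  have "inj_on (\<lambda>i. int (part \<kappa> (Suc i)) - int i + int (length \<kappa>) - 1) {..<length \<kappa>}"
  proof (rule linorder_inj_onI)
    fix i j :: nat assume "i < j"
    then show "int (part \<kappa> (Suc i)) - int i + int (length \<kappa>) - 1
      \<noteq> int (part \<kappa> (Suc j)) - int j + int (length \<kappa>) - 1"
      using part_antimono[OF \<kappa>, of "Suc i" "Suc j"] by simp
  qed auto
  then have "card (int ` first_column_hooks \<kappa>) = length \<kappa>"
    unfolding first_column_hooks_eq[OF \<kappa>] by (simp add: card_image)
  then show ?thesis by (simp add: card_image)
qed

text \<open>The zero parts beyond the length contribute all integers up to
  \<open>- length \<kappa>\<close>; the positive parts contribute the hook lengths,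
  translated.\<close>

lemma mem_alpha_iff_hooks:
  assumes \<kappa>: "is_partition \<kappa>"
  shows "z \<in> alpha \<kappa> \<longleftrightarrow>
    z \<le> - int (length \<kappa>) \<or> z + int (length \<kappa>) - 1 \<in> int ` first_column_hooks \<kappa>"
proof
  assume "z \<in> alpha \<kappa>"
  then obtain i where i: "z = int (part \<kappa> (Suc i)) - int i" unfolding alpha_eq_range by auto
  show "z \<le> - int (length \<kappa>) \<or> z + int (length \<kappa>) - 1 \<in> int ` first_column_hooks \<kappa>"
  proof (cases "i < length \<kappa>")
    case True
    then show ?thesis unfolding first_column_hooks_eq[OF \<kappa>] using i by force
  next
    case False
    then show ?thesis using i by (simp add: part_Suc)
  qed
next
  assume "z \<le> - int (length \<kappa>) \<or> z + int (length \<kappa>) - 1 \<in> int ` first_column_hooks \<kappa>"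
  then show "z \<in> alpha \<kappa>"
  proof
    assume "z \<le> - int (length \<kappa>)"
    then have "z = int (part \<kappa> (Suc (nat (- z)))) - int (nat (- z))"
      by (simp add: part_Suc)
    then show ?thesis unfolding alpha_eq_range by blast
  next
    assume "z + int (length \<kappa>) - 1 \<in> int ` first_column_hooks \<kappa>"
    then show ?thesis unfolding first_column_hooks_eq[OF \<kappa>] alpha_eq_range by auto
  qed
qed

text \<open>The cardinality of the hook set recovers the length, and the two together recover the
  beta-set.\<close>

lemma first_column_hooks_inject:
  assumes "is_partition \<kappa>" "is_partition \<mu>" "first_column_hooks \<kappa> = first_column_hooks \<mu>"
  shows "\<kappa> = \<mu>"
proof (rule alpha_inject[OF assms(1,2)])
  have "length \<kappa> = length \<mu>" using assms card_first_column_hooks by metis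
  then show "alpha \<kappa> = alpha \<mu>"
    using assms(3) by (auto simp: mem_alpha_iff_hooks assms(1,2))
qed

text \<open>If \<open>H\<close> is listed increasingly, subtracting its index from each entry leaves
  a weakly increasing positive sequence. Read backwards, it is the required partition.\<close>

lemma ex_partition_with_hooks:
  assumes "finite H" and pos: "\<And>h. h \<in> H \<Longrightarrow> (0::int) < h"
  shows "\<exists>\<kappa>. is_partition \<kappa> \<and> int ` first_column_hooks \<kappa> = H"
proof -
  define hs where "hs = sorted_list_of_set H"
  define l where "l = length hs"
  define g where "g i = hs ! i - int i" for i
  have hs: "set hs = H" "sorted_wrt (<) hs" using \<open>finite H\<close> unfolding hs_def by auto
  have step: "g i \<le> g (Suc i)" if "Suc i < l" for i
    using sorted_wrt_nth_less[OF hs(2), of i "Suc i"] that unfolding l_def g_def by simp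
  have g_mono: "g i \<le> g j" if "i \<le> j" "j < l" for i j
    using that by (induction j) (auto simp: le_Suc_eq intro: order_trans[OF _ step])
  have g_pos: "0 < g i" if "i < l" for i
  proof -
    have "hs ! 0 \<in> H" using that hs(1) nth_mem[of 0 hs] unfolding l_def by (cases hs) auto
    then have "0 < g 0" using pos unfolding g_def by simp
    then show ?thesis using g_mono[of 0 i] that by simp
  qed
  define \<kappa> where "\<kappa> = map (\<lambda>i. nat (g (l - 1 - i))) [0..<l]"
  have len: "length \<kappa> = l" by (simp add: \<kappa>_def)
  have \<kappa>: "is_partition \<kappa>"
    unfolding is_partition_def sorted_wrt_iff_nth_less
    using g_pos g_mono by (auto simp: \<kappa>_def intro!: nat_mono)
  have part: "int (part \<kappa> (Suc i)) = g (l - 1 - i)" if "i < l" for i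
    using that g_pos[of "l - 1 - i"] by (simp add: part_Suc len) (simp add: \<kappa>_def)
  have "int ` first_column_hooks \<kappa> = (\<lambda>i. hs ! (l - 1 - i)) ` {..<l}"
    unfolding first_column_hooks_eq[OF \<kappa>] len
    by (rule image_cong) (auto simp: part g_def)
  also have "\<dots> = (!) hs ` (\<lambda>i. l - 1 - i) ` {..<l}" by (simp add: image_image)
  also have "(\<lambda>i. l - 1 - i) ` {..<l} = {..<l}"
  proof (rule set_eqI, rule iffI)
    fix i assume "i \<in> {..<l}"
    then show "i \<in> (\<lambda>i. l - 1 - i) ` {..<l}" by (intro image_eqI[of _ _ "l - 1 - i"]) auto
  qed auto
  also have "(!) hs ` {..<l} = H" using hs(1) unfolding l_def by (auto simp: set_conv_nth)
  finally show ?thesis using \<kappa> by blast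
qed

subsection \<open>Lattice paths\<close>

lemma count_list_take_Suc:
  "k < length x \<Longrightarrow>
    count_list (take (Suc k) x) s = count_list (take k x) s + (if x ! k = s then 1 else 0)"
  by (simp add: take_Suc_conv_app_nth)

lemma count_list_take_mono:
  assumes "i \<le> j"
  shows "count_list (take i x) s \<le> count_list (take j x) s"
proof -
  obtain d where "j = i + d" using assms le_iff_add by blast
  then show ?thesis by (simp add: take_add)
qed

lemma count_list_take_le: "count_list (take k x) s \<le> count_list x s"
  using count_list_append[of "take k x" "drop k x" s] by simp

lemma count_list_steps: "count_list x North + count_list x East = length x"
proof (induction x)
  case (Cons s x)
  then show ?case by (cases s) auto
qed simp

lemma card_steps: "card {k. k < length x \<and> x ! k = s} = count_list x s"
  by (simp add: count_list_eq_length_filter length_filter_conv_card eq_commute)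

lemma ex_north_step:
  "j < count_list x North \<Longrightarrow> \<exists>m < length x. x ! m = North \<and> count_list (take m x) North = j"
proof (induction x rule: rev_induct)
  case (snoc s x)
  show ?case
  proof (cases "j < count_list x North")
    case True
    then obtain m where "m < length x" "x ! m = North" "count_list (take m x) North = j"
      using snoc.IH by blast
    then show ?thesis by (intro exI[of _ m]) (simp add: nth_append)
  next
    case False
    then have "s = North" "j = count_list x North" using snoc.prems by (auto split: if_splits)
    then show ?thesis by (intro exI[of _ "length x"]) simp
  qed
qed simp

text \<open>Exactly \<open>j\<close> North steps precede position \<open>m\<close>, so
  \<open>m\<close> is entry \<open>j\<close> of the list of North positions. The shift to
  \<open>Suc j\<close> arises because \<open>easts_before\<close> numbers North steps from
  one.\<close>

lemma easts_before_eq: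
  assumes m: "m < length x" "x ! m = North" and j: "count_list (take m x) North = j"
  shows "easts_before x (Suc j) = count_list (take m x) East"
proof -
  let ?P = "\<lambda>k. x ! k = North"
  have "length (filter ?P [0..<i]) = count_list (take i x) North" if "i \<le> length x" for i
    using that by (induction i) (auto simp: count_list_take_Suc)
  then have len: "length (filter ?P [0..<m]) = j" using m j by simp
  have "[0..<length x] = [0..<m] @ m # [Suc m..<length x]"
    using m(1) upt_add_eq_append[of 0 m "length x - m"] upt_conv_Cons[of m "length x"] by simp
  then have "filter ?P [0..<length x] = filter ?P [0..<m] @ m # filter ?P [Suc m..<length x]"
    using m(2) by simp
  then have "filter ?P [0..<length x] ! j = m" using len by (simp add: nth_append)
  then show ?thesis by (simp add: easts_before_def)
qed

lemma count_easts_le_easts_before: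
  assumes "k \<le> length x" and j: "count_list (take k x) North = j" "j < count_list x North"
  shows "count_list (take k x) East \<le> easts_before x (Suc j)"
proof -
  obtain m where m: "m < length x" "x ! m = North" "count_list (take m x) North = j"
    using ex_north_step[OF j(2)] by blast
  have "k \<le> m"
    using count_list_take_mono[of "Suc m" k x North] count_list_take_Suc[OF m(1), of North] m j
    by (cases "k \<le> m") auto
  then show ?thesis using easts_before_eq[OF m] count_list_take_mono by simp
qed

lemma easts_before_le_count_easts:
  assumes j: "j < count_list (take k x) North"
  shows "easts_before x (Suc j) \<le> count_list (take k x) East"
proof -
  obtain m where m: "m < length x" "x ! m = North" "count_list (take m x) North = j"
    using ex_north_step[of j x] j count_list_take_le[of k x North] by auto
  have "m \<le> k"
    using count_list_take_mono[of k m x North] m(3) j by (cases "m \<le> k") auto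
  then show ?thesis using easts_before_eq[OF m] count_list_take_mono by simp
qed

text \<open>Induction on the height: a path for the lower rows that ends at abscissa
  \<open>a n\<close> is extended by a North step and then by the missing East steps.\<close>

lemma ex_path_with_easts_before:
  fixes a :: "nat \<Rightarrow> nat"
  assumes "\<And>i j. i \<le> j \<Longrightarrow> j < n \<Longrightarrow> a i \<le> a j" and "\<And>j. j < n \<Longrightarrow> a j \<le> q"
  shows "\<exists>x. count_list x North = n \<and> count_list x East = q \<and>
    (\<forall>j < n. easts_before x (Suc j) = a j)"
  using assms
proof (induction n arbitrary: q)
  case 0
  have "count_list (replicate q East) North = 0 \<and> count_list (replicate q East) East = q"
    by (induction q) auto
  then show ?case by (intro exI[of _ "replicate q East"]) simp
next
  case (Suc n)
  have "\<exists>x. count_list x North = n \<and> count_list x East = a n \<and>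
    (\<forall>j < n. easts_before x (Suc j) = a j)"
    by (rule Suc.IH) (use Suc.prems in auto)
  then obtain x where x: "count_list x North = n" "count_list x East = a n"
    "\<And>j. j < n \<Longrightarrow> easts_before x (Suc j) = a j" by blast
  define y where "y = x @ North # replicate (q - a n) East"
  have rep: "count_list (replicate d East) North = 0 \<and> count_list (replicate d East) East = d" for d
    by (induction d) auto
  have "count_list y North = Suc n" "count_list y East = q"
    using x rep[of "q - a n"] Suc.prems(2)[of n] by (auto simp: y_def)
  moreover have "easts_before y (Suc j) = a j" if "j < Suc n" for j
  proof (cases "j = n")
    case True
    then show ?thesis using easts_before_eq[of "length x" y n] x by (simp add: y_def)
  next
    case False
    then have "j < n" using that by simp
    then obtain m where m: "m < length x" "x ! m = North" "count_list (take m x) North = j"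
      using ex_north_step x(1) by blast
    then have "easts_before y (Suc j) = count_list (take m y) East"
      by (intro easts_before_eq) (auto simp: y_def nth_append)
    then show ?thesis using easts_before_eq[OF m] m x(3)[OF \<open>j < n\<close>] by (simp add: y_def)
  qed
  ultimately show ?case by blast
qed

section \<open>Labels and the maps \<open>zeta\<close> and \<open>phi\<close>\<close>

lemma label_inject:
  assumes "coprime n p" "0 < n" "label n p i j = label n p i' j'" "j < n" "j' < n"
  shows "i = i' \<and> j = j'"
proof -
  have eq: "(int j - int j') * int p = (int i - int i') * int n"
    using assms(3) unfolding label_def by (simp add: algebra_simps)
  then have "int n dvd (int j - int j') * int p" by simp
  then have "int n dvd int j - int j'"
    using assms(1) by (simp add: coprime_dvd_mult_left_iff)
  then have "int j - int j' = 0"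
    using assms(4,5) dvd_imp_le_int[of "int j - int j'" "int n"] by linarith
  then show ?thesis using eq assms(2) by simp
qed

text \<open>The counterpart with bounded abscissae in place of bounded heights; it also serves for
  points at height \<open>n\<close>, which East steps may have.\<close>

lemma label_inject':
  assumes "coprime n p" "0 < p" "label n p i j = label n p i' j'" "\<bar>int i - int i'\<bar> < int p"
  shows "i = i' \<and> j = j'"
proof -
  have eq: "(int j - int j') * int p = (int i - int i') * int n"
    using assms(3) unfolding label_def by (simp add: algebra_simps)
  then have "int p dvd (int i - int i') * int n" by (metis dvd_triv_right)
  then have "int p dvd int i - int i'"
    using assms(1) by (simp add: coprime_dvd_mult_left_iff coprime_commute)
  then have "int i - int i' = 0" using assms(4) dvd_imp_le_int[of "int i - int i'" "int p"] by linarith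
  then show ?thesis using eq assms(2) by simp
qed

text \<open>With distinct labels, the steps standing before step \<open>q\<close> after sorting are
  exactly those of smaller label. If \<open>j\<close> of them are North, step \<open>q\<close>
  becomes the North step number \<open>Suc j\<close>.\<close>

lemma easts_before_zeta:
  assumes inj: "inj_on (step_label n p x) {..<length x}"
    and q: "q < length x" "x ! q = North"
    and j: "card {k. k < length x \<and> x ! k = North \<and> step_label n p x k < step_label n p x q} = j"
  shows "easts_before (zeta n p x) (Suc j) =
    card {k. k < length x \<and> x ! k = East \<and> step_label n p x k < step_label n p x q}"
proof -
  let ?f = "step_label n p x"
  define L where "L = sort_key ?f [0..<length x]"
  have L: "set L = {..<length x}" "distinct L" "length L = length x"
    by (auto simp: L_def)
  have "sorted_wrt (<) (map ?f L)"
    using inj L by (auto simp: strict_sorted_iff distinct_map L_def)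
  then have less_iff: "?f (L ! a) < ?f (L ! b) \<longleftrightarrow> a < b" if "a < length L" "b < length L" for a b
    using sorted_wrt_nth_less[of "(<)" "map ?f L"] that
    by (metis length_map linorder_less_linear nth_map order_less_asym)
  obtain m where m: "m < length L" "L ! m = q" using q(1) L(1) by (metis in_set_conv_nth lessThan_iff)
  have set_take: "set (take m L) = {k. k < length x \<and> ?f k < ?f q}"
  proof (rule set_eqI, rule iffI)
    fix k assume "k \<in> set (take m L)"
    then obtain a where "a < m" "k = L ! a" using m by (auto simp: in_set_conv_nth)
    moreover have "L ! a \<in> set L" using calculation m by simp
    ultimately show "k \<in> {k. k < length x \<and> ?f k < ?f q}" using m L less_iff[of a m] by auto
  next
    fix k assume k: "k \<in> {k. k < length x \<and> ?f k < ?f q}"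
    then obtain a where a: "a < length L" "k = L ! a"
      using L(1) by (metis (mono_tags) in_set_conv_nth lessThan_iff mem_Collect_eq)
    then have "a < m" using k m less_iff[of a m] by simp
    then show "k \<in> set (take m L)" using a m by (auto simp: in_set_conv_nth)
  qed
  have zeta: "zeta n p x = map ((!) x) L" by (simp add: zeta_def L_def)
  have count: "count_list (take m (zeta n p x)) s = card {k. k < length x \<and> x ! k = s \<and> ?f k < ?f q}"
    for s
  proof -
    have "count_list (take m (zeta n p x)) s = length (filter (\<lambda>k. x ! k = s) (take m L))"
      unfolding zeta take_map count_list_eq_length_filter filter_map
      by (simp add: comp_def eq_commute)
    also have "\<dots> = card (set (filter (\<lambda>k. x ! k = s) (take m L)))"
      using L(2) by (simp only: distinct_card distinct_filter distinct_take)
    also have "set (filter (\<lambda>k. x ! k = s) (take m L)) = {k. k < length x \<and> x ! k = s \<and> ?f k < ?f q}"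
      using set_take by auto
    finally show ?thesis .
  qed
  show ?thesis
    using easts_before_eq[of m "zeta n p x" j] m q L j by (simp add: count zeta)
      (simp add: count flip: zeta)
qed

lemma phi_hooks:
  "is_partition (phi n p x) \<and> int ` first_column_hooks (phi n p x) = pos_labels n p x"
  unfolding phi_def
proof (rule theI')
  have "pos_labels n p x \<subseteq> (\<lambda>(i, j). label n p i j) ` ({..p} \<times> {..<n})"
    unfolding pos_labels_def by auto
  then have "finite (pos_labels n p x)" by (rule finite_subset) simp
  moreover have pos: "0 < h" if "h \<in> pos_labels n p x" for h
    using that unfolding pos_labels_def by auto
  ultimately obtain \<kappa> where "is_partition \<kappa>" "int ` first_column_hooks \<kappa> = pos_labels n p x"
    using ex_partition_with_hooks[of "pos_labels n p x"] pos by blast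
  then show "\<exists>!\<kappa>. is_partition \<kappa> \<and> int ` first_column_hooks \<kappa> = pos_labels n p x"
    using first_column_hooks_inject by (metis inj_image_eq_iff inj_of_nat)
qed

lemma phi_eqI:
  assumes "is_partition \<kappa>" "int ` first_column_hooks \<kappa> = pos_labels n p x"
  shows "phi n p x = \<kappa>"
  using phi_hooks[of n p x] assms first_column_hooks_inject by (metis inj_image_eq_iff inj_of_nat)

subsection \<open>Semimodules\<close>

text \<open>The complement of the beta-set of an \<open>n, p\<close>-core, normalised to have least element 0.\<close>

locale semimodule =
  fixes n p :: nat and D :: "int set"
  assumes n_pos: "0 < n" and p_pos: "0 < p" and coprime: "coprime n p"
    and nonneg: "z \<in> D \<Longrightarrow> 0 \<le> z" and zero: "0 \<in> D"
    and add_n: "z \<in> D \<Longrightarrow> z + int n \<in> D" and add_p: "z \<in> D \<Longrightarrow> z + int p \<in> D"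
begin

lemma add_mult_n:
  assumes "z \<in> D" "0 \<le> k"
  shows "z + k * int n \<in> D"
  using assms(2)
proof (induction k rule: int_ge_induct)
  case (step k)
  then show ?case using add_n[of "z + k * int n"] by (simp add: algebra_simps)
qed (simp add: assms)

lemma add_mult_p:
  assumes "z \<in> D" "0 \<le> k"
  shows "z + k * int p \<in> D"
  using assms(2)
proof (induction k rule: int_ge_induct)
  case (step k)
  then show ?case using add_p[of "z + k * int p"] by (simp add: algebra_simps)
qed (simp add: assms)

text \<open>Surjectivity in Anderson's correspondence. At each height the points with label in
  \<open>D\<close> form an initial segment of the row, by closure under adding \<open>n\<close>;
  closure under adding \<open>p\<close> makes the segments grow with the height, so their ends trace
  a path.\<close>

lemma ex_dyck_path: "\<exists>x \<in> dyck_paths n p. pos_labels n p x = {h. 0 < h \<and> h \<notin> D}"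
proof -
  \<comment> \<open>The greatest element exists: abscissa 0 qualifies since \<open>D\<close>
    contains 0 and is closed under adding \<open>p\<close>, and nonnegativity of \<open>D\<close>
    bounds the abscissa.\<close>
  define a where "a j = (GREATEST i. label n p i j \<in> D)" for j
  have bound: "i * n \<le> j * p" if "label n p i j \<in> D" for i j
    using nonneg[OF that] unfolding label_def by (simp flip: of_nat_mult)
  have bound': "i \<le> j * p" if "label n p i j \<in> D" for i j
  proof -
    have "i \<le> i * n" using n_pos by simp
    then show ?thesis using bound[OF that] by (rule order_trans)
  qed
  have col0: "label n p 0 j \<in> D" for j
    using add_mult_p[OF zero, of "int j"] by (simp add: label_def)
  have a_mem: "label n p (a j) j \<in> D" for j
    unfolding a_def using GreatestI_nat[of "\<lambda>i. label n p i j \<in> D" 0 "j * p"] col0 bound' by blast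
  have a_max: "i \<le> a j" if "label n p i j \<in> D" for i j
    unfolding a_def using Greatest_le_nat[of "\<lambda>i. label n p i j \<in> D" i "j * p"] that bound' by blast
  have mem_iff: "label n p i j \<in> D \<longleftrightarrow> i \<le> a j" for i j
  proof
    assume "i \<le> a j"
    then have "label n p i j = label n p (a j) j + (int (a j) - int i) * int n"
      by (simp add: label_def algebra_simps)
    then show "label n p i j \<in> D" using add_mult_n[OF a_mem, of "int (a j) - int i"] \<open>i \<le> a j\<close> by simp
  qed (rule a_max)
  have a_mono: "a i \<le> a j" if "i \<le> j" for i j
  proof (rule a_max)
    have "label n p (a i) j = label n p (a i) i + (int j - int i) * int p"
      by (simp add: label_def algebra_simps)
    then show "label n p (a i) j \<in> D" using add_mult_p[OF a_mem, of "int j - int i"] that by simp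
  qed
  have a_le: "a j \<le> p" if "j < n" for j
  proof -
    have "a j * n \<le> p * n" using bound[OF a_mem, of j] that
      by (metis less_imp_le mult.commute mult_le_mono1 order_trans)
    then show ?thesis using n_pos by simp
  qed
  obtain x where x: "count_list x North = n" "count_list x East = p"
    "\<And>j. j < n \<Longrightarrow> easts_before x (Suc j) = a j"
    using ex_path_with_easts_before[of n a p] a_mono a_le by auto
  have "0 \<le> step_label n p x k" if "k \<le> length x" for k
  proof -
    define i j where "i = count_list (take k x) East" and "j = count_list (take k x) North"
    have ij: "i \<le> p" "j \<le> n" using count_list_take_le[of k x] x by (auto simp: i_def j_def)
    show ?thesis
    proof (cases "j < n")
      case True
      then have "i \<le> a j"
        using count_easts_le_easts_before[OF that, of j] x by (simp add: i_def j_def)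
      then show ?thesis using mem_iff nonneg unfolding step_label_def i_def j_def by blast
    next
      case False
      then have "j = n" using ij by simp
      have "i * n \<le> p * n" using ij by simp
      then show ?thesis unfolding step_label_def label_def i_def[symmetric] j_def[symmetric] \<open>j = n\<close>
        by (simp add: mult.commute flip: of_nat_mult)
    qed
  qed
  then have dyck: "x \<in> dyck_paths n p" using x by (simp add: dyck_paths_def)
  have "pos_labels n p x = {h. 0 < h \<and> h \<notin> D}"
  proof (rule set_eqI, rule iffI)
    fix h assume "h \<in> pos_labels n p x"
    then obtain i j where "h = label n p i j" "1 \<le> i" "j < n" "a j \<le> i - 1" "0 < h"
      unfolding pos_labels_def using x(3) by auto
    then show "h \<in> {h. 0 < h \<and> h \<notin> D}" using mem_iff by auto
  next
    fix h assume "h \<in> {h. 0 < h \<and> h \<notin> D}"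
    then have h: "0 < h" "h \<notin> D" by auto
    have "coprime (int p) (int n)" using coprime by (simp add: coprime_commute)
    \<comment> \<open>Solving this congruence writes \<open>h\<close> as the label of a point at
      height \<open>j < n\<close>. Its abscissa \<open>t\<close> is positive, as otherwise
      \<open>h\<close> would arise from column 0 by adding multiples of \<open>n\<close> and lie in
      \<open>D\<close>.\<close>
    then obtain c where c: "[int p * c = h] (mod int n)"
      using cong_solve_coprime_int[of "int p" "int n"] by (metis cong_scalar_right mult.assoc mult.left_neutral)
    define j where "j = nat (c mod int n)"
    have j: "int j = c mod int n" "j < n" using n_pos by (auto simp: j_def nat_less_iff)
    have "[int j * int p = h] (mod int n)"
      using c unfolding j(1) by (simp add: cong_def mod_mult_right_eq mult.commute)
    then have "int n dvd int j * int p - h" by (simp add: cong_iff_dvd_diff)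
    then obtain t where t: "int j * int p - h = int n * t" by blast
    have "0 < t"
    proof (rule ccontr)
      assume "\<not> 0 < t"
      then have "label n p 0 j + (- t) * int n \<in> D" by (intro add_mult_n col0) simp
      moreover have "label n p 0 j + (- t) * int n = h" using t by (simp add: label_def algebra_simps)
      ultimately show False using h by simp
    qed
    define i where "i = nat t"
    have i: "h = label n p i j" "1 \<le> i" using t \<open>0 < t\<close> by (auto simp: i_def label_def algebra_simps)
    have "i * n < j * p" using h(1) unfolding i(1) label_def by (simp flip: of_nat_mult)
    also have "\<dots> < n * p" using j p_pos by simp
    finally have "i \<le> p" by (simp add: mult.commute)
    moreover have "a j \<le> i - 1" using h(2) i mem_iff by auto
    ultimately show "h \<in> pos_labels n p x" unfolding pos_labels_def using i j h x(3) by fastforce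
  qed
  then show ?thesis using dyck by blast
qed

text \<open>The path is arbitrary apart from its positive labels, because \<open>phi_inv\<close>
  chooses a preimage and only the label set of that preimage is known.\<close>

context
  fixes x assumes dyck: "x \<in> dyck_paths n p" and pos: "pos_labels n p x = {h. 0 < h \<and> h \<notin> D}"
begin

lemma counts: "count_list x North = n" "count_list x East = p" "length x = n + p"
  using dyck count_list_steps[of x] by (auto simp: dyck_paths_def)

lemma step_label_nonneg: "k \<le> length x \<Longrightarrow> 0 \<le> step_label n p x k"
  using dyck by (simp add: dyck_paths_def)

text \<open>Squares below the path have positive labels outside \<open>D\<close> by assumption.
  Label 0 belongs only to the origin among heights below \<open>n\<close>, and negative labels never
  lie in \<open>D\<close>.\<close>

lemma label_notin_semimodule:
  assumes "1 \<le> i" "i \<le> p" "j < n" "easts_before x (Suc j) \<le> i - 1"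
  shows "label n p i j \<notin> D"
proof (cases "0 < label n p i j")
  case True
  then have "label n p i j \<in> pos_labels n p x" using assms unfolding pos_labels_def by force
  then show ?thesis using pos by simp
next
  case False
  moreover have "label n p i j \<noteq> label n p 0 0"
    using label_inject[OF coprime n_pos, of i j 0 0] assms by auto
  ultimately have "label n p i j < 0" by (simp add: label_def)
  then show ?thesis using nonneg by force
qed

text \<open>The starting point has a nonnegative label that no square below the path carries. The
  point one unit to its right is the corner of a square below the path, and its label is smaller by
  \<open>n\<close>.\<close>

lemma north_label:
  assumes k: "k < length x" "x ! k = North"
  shows "step_label n p x k \<in> D" "step_label n p x k - int n \<notin> D"
proof -
  define i j where "i = count_list (take k x) East" and "j = count_list (take k x) North"
  have lab: "step_label n p x k = label n p i j" by (simp add: step_label_def i_def j_def)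
  have eb: "easts_before x (Suc j) = i" using easts_before_eq[OF k] by (simp add: i_def j_def)
  have "j < count_list x North"
    using count_list_take_le[of "Suc k" x North] count_list_take_Suc[OF k(1), of North] k by (simp add: j_def)
  then have j: "j < n" using counts by simp
  have "0 \<le> label n p i j" using step_label_nonneg[of k] k lab by simp
  then have "i * n \<le> j * p" by (simp add: label_def flip: of_nat_mult)
  also have "\<dots> < n * p" using j p_pos by simp
  finally have i: "i < p" by (simp add: mult.commute)
  have "label n p i j \<notin> pos_labels n p x"
  proof
    assume "label n p i j \<in> pos_labels n p x"
    then obtain i' j' where "label n p i j = label n p i' j'" "1 \<le> i'" "j' < n"
      "easts_before x (Suc j') \<le> i' - 1" unfolding pos_labels_def by auto
    then show False using label_inject[OF coprime n_pos, of i j i' j'] j eb by auto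
  qed
  then show "step_label n p x k \<in> D" using pos \<open>0 \<le> label n p i j\<close> zero lab by force
  have "label n p (Suc i) j \<notin> D" using label_notin_semimodule[of "Suc i" j] i j eb by simp
  then show "step_label n p x k - int n \<notin> D" unfolding lab by (simp add: label_def algebra_simps)
qed

text \<open>Subtracting \<open>n\<close> passes to the end point of the step, which is on the path;
  subtracting \<open>p\<close> as well passes to the point one unit lower, which is below the
  path.\<close>

lemma east_label:
  assumes k: "k < length x" "x ! k = East"
  shows "step_label n p x k - int n \<in> D" "step_label n p x k - int n - int p \<notin> D"
proof -
  define i j where "i = count_list (take k x) East" and "j = count_list (take k x) North"
  have lab: "step_label n p x k - int n = label n p (Suc i) j"
    by (simp add: step_label_def i_def j_def label_def algebra_simps)
  have next_k: "count_list (take (Suc k) x) East = Suc i" "count_list (take (Suc k) x) North = j"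
    using count_list_take_Suc[OF k(1)] k by (auto simp: i_def j_def)
  have i: "Suc i \<le> p" using count_list_take_le[of "Suc k" x East] next_k counts by simp
  have "0 \<le> label n p (Suc i) j"
    using step_label_nonneg[of "Suc k"] k next_k by (simp add: step_label_def)
  moreover have "label n p (Suc i) j \<notin> pos_labels n p x"
  proof
    assume "label n p (Suc i) j \<in> pos_labels n p x"
    then obtain i' j' where ij': "label n p (Suc i) j = label n p i' j'" "1 \<le> i'" "i' \<le> p" "j' < n"
      "easts_before x (Suc j') \<le> i' - 1" unfolding pos_labels_def by auto
    then have "Suc i = i' \<and> j = j'" using label_inject'[OF coprime p_pos, of "Suc i" j i' j'] i by auto
    then show False
      using count_easts_le_easts_before[of "Suc k" x j] k next_k ij' counts by simp
  qed
  ultimately show "step_label n p x k - int n \<in> D" using pos zero lab by force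
  show "step_label n p x k - int n - int p \<notin> D"
  proof (cases j)
    case 0
    \<comment> \<open>At height 0 there is no row beneath, so negativity of the label replaces the
      argument with squares.\<close>
    have "label n p (Suc i) 0 - int p < 0" using p_pos by (simp add: label_def order.strict_trans1[of _ 0])
    then show ?thesis using nonneg unfolding lab 0 by force
  next
    case (Suc j')
    have "j \<le> n" using count_list_take_le[of k x North] counts by (simp add: j_def)
    then have "label n p (Suc i) j' \<notin> D"
      using label_notin_semimodule[of "Suc i" j'] i easts_before_le_count_easts[of j' k x] Suc
      by (simp add: i_def j_def)
    then show ?thesis unfolding lab Suc by (simp add: label_def algebra_simps)
  qed
qed

text \<open>Points with equal labels and abscissae less than \<open>p\<close> apart coincide.
  Otherwise the abscissae are 0 and \<open>p\<close> and the heights differ by \<open>n\<close>,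
  which only the two ends of the path achieve, and no step starts at the last point.\<close>

lemma inj_step_label: "inj_on (step_label n p x) {..<length x}"
proof (rule linorder_inj_onI)
  fix k l assume kl: "k < l" "k \<in> {..<length x}" "l \<in> {..<length x}"
  define i j where "i = count_list (take k x) East" and "j = count_list (take k x) North"
  define i' j' where "i' = count_list (take l x) East" and "j' = count_list (take l x) North"
  have sum: "i + j = k" "i' + j' = l"
    using count_list_steps[of "take k x"] count_list_steps[of "take l x"] kl
    by (auto simp: i_def j_def i'_def j'_def)
  have le: "i \<le> i'" "j \<le> j'" "i' \<le> p" "j' \<le> n"
    using count_list_take_mono[of k l x] count_list_take_le[of l x] kl counts
    by (auto simp: i_def j_def i'_def j'_def)
  show "step_label n p x k \<noteq> step_label n p x l"
  proof
    assume "step_label n p x k = step_label n p x l"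
    then have eq: "label n p i j = label n p i' j'"
      by (simp add: step_label_def i_def j_def i'_def j'_def)
    show False
    proof (cases "i' - i < p")
      case True
      then have "\<bar>int i - int i'\<bar> < int p" using le by linarith
      then show False using label_inject'[OF coprime p_pos eq] sum kl by auto
    next
      case False
      then have "i = 0" "i' = p" using le by auto
      then have "int (j' - j) * int p = int p * int n" using eq le by (simp add: label_def algebra_simps)
      then have "j' - j = n" using p_pos by simp
      then show False using sum kl le counts \<open>i' = p\<close> by simp
    qed
  qed
qed auto

text \<open>East labels represent every residue class modulo \<open>p\<close> exactly once, so each of them below
  \<open>v\<close> can be moved within its class into the window \<open>{v - p<..<v}\<close>.\<close>

lemma card_east_labels_below:
  assumes v: "v - int n \<notin> D"
  shows "card {k. k < length x \<and> x ! k = East \<and> step_label n p x k < v} =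
    card {a. v - int p < a \<and> a < v \<and> a - int n \<in> D}"
proof -
  let ?f = "step_label n p x"
  define E where "E = {k. k < length x \<and> x ! k = East}"
  \<comment> \<open>The offset for which \<open>v - p + r k\<close> is the representative of the
    East label's class in the half-open window from \<open>v - p\<close> to
    \<open>v\<close>.\<close>
  define r where "r k = (?f k - v) mod int p" for k
  have finE: "finite E" and cardE: "card E = p"
    using card_steps[of x East] counts by (auto simp: E_def)
  \<comment> \<open>Modulo \<open>p\<close> a label depends only on its abscissa times
    \<open>n\<close>; East steps start at distinct abscissae below \<open>p\<close>, and
    \<open>n\<close> is invertible modulo \<open>p\<close>.\<close>
  have inj: "inj_on r E"
  proof (rule linorder_inj_onI)
    fix k l assume kl: "k < l" "k \<in> E" "l \<in> E"
    define i i' where "i = count_list (take k x) East" and "i' = count_list (take l x) East"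
    have "count_list (take (Suc k) x) East = Suc i" "count_list (take (Suc l) x) East = Suc i'"
      using kl count_list_take_Suc[of _ x East] by (auto simp: E_def i_def i'_def)
    then have i: "i < i'" "i' < p"
      using count_list_take_mono[of "Suc k" l x East] count_list_take_le[of "Suc l" x East] kl counts
      by (auto simp: i'_def)
    show "r k \<noteq> r l"
    proof
      assume "r k = r l"
      then have "int p dvd (?f k - v) - (?f l - v)"
        unfolding r_def by (simp only: mod_eq_dvd_iff)
      moreover have "(?f k - v) - (?f l - v) =
        (int (count_list (take k x) North) - int (count_list (take l x) North)) * int p
        + (int i' - int i) * int n"
        by (simp add: step_label_def label_def i_def i'_def algebra_simps)
      ultimately have "int p dvd (int i' - int i) * int n"
        by (simp add: dvd_add_right_iff)
      then have "int p dvd int i' - int i"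
        using coprime by (simp add: coprime_dvd_mult_left_iff coprime_commute)
      then show False using i zdvd_imp_le[of "int p" "int i' - int i"] by simp
    qed
  qed auto
  have range_r: "r ` E = {0..<int p}"
  proof (rule card_subset_eq)
    show "r ` E \<subseteq> {0..<int p}" using p_pos by (auto simp: r_def)
  qed (use inj cardE in \<open>auto simp: card_image\<close>)
  have f_eq: "?f k = v - int p + r k + ((?f k - v) div int p + 1) * int p" for k
    using div_mult_mod_eq[of "?f k - v" "int p"] by (simp add: r_def algebra_simps)
  have image: "(\<lambda>k. v - int p + r k) ` {k \<in> E. ?f k < v} = {a. v - int p < a \<and> a < v \<and> a - int n \<in> D}"
  proof (rule set_eqI, rule iffI)
    fix a assume "a \<in> (\<lambda>k. v - int p + r k) ` {k \<in> E. ?f k < v}"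
    then obtain k where k: "k \<in> E" "?f k < v" "a = v - int p + r k" by auto
    define d where "d = (?f k - v) div int p + 1"
    have "(?f k - v) div int p < 0" using k p_pos by (intro div_neg_pos_less0) auto
    then have "d \<le> 0" by (simp add: d_def)
    have "?f k - int n \<in> D" using east_label(1) k(1) by (auto simp: E_def)
    \<comment> \<open>A label below \<open>v\<close> moves upwards into the window, so closure under
      adding \<open>p\<close> keeps it in \<open>D\<close> after subtraction of
      \<open>n\<close>.\<close>
    then have "?f k - int n + (- d) * int p \<in> D" using \<open>d \<le> 0\<close> by (intro add_mult_p) auto
    moreover have "?f k - int n + (- d) * int p = a - int n"
      using f_eq[of k] k(3) unfolding d_def[symmetric] by (simp add: algebra_simps)
    ultimately have a: "a - int n \<in> D" by metis
    \<comment> \<open>The lower end of the window is excluded: there, adding \<open>p\<close> would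
      put \<open>v - n\<close> into \<open>D\<close>.\<close>
    have "a \<noteq> v - int p" using add_p[OF a] v by (auto simp: algebra_simps)
    moreover have "r k \<in> {0..<int p}" using k(1) range_r by blast
    ultimately show "a \<in> {a. v - int p < a \<and> a < v \<and> a - int n \<in> D}" using a k(3) by auto
  next
    fix a assume "a \<in> {a. v - int p < a \<and> a < v \<and> a - int n \<in> D}"
    then have a: "v - int p < a" "a < v" "a - int n \<in> D" by auto
    then have "a - v + int p \<in> r ` E" unfolding range_r by auto
    then obtain k where k: "k \<in> E" "a = v - int p + r k" by auto
    have "?f k < v"
    proof (rule ccontr)
      assume "\<not> ?f k < v"
      then have "0 \<le> (?f k - v) div int p" using p_pos by (simp add: pos_imp_zdiv_nonneg_iff)
      \<comment> \<open>A label at or above \<open>v\<close> would be reached from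
        \<open>a + p\<close> by adding multiples of \<open>p\<close>, which puts the label minus
        \<open>n + p\<close> into \<open>D\<close>, against \<open>east_label\<close>.\<close>
      then have "a - int n + ((?f k - v) div int p) * int p \<in> D" by (intro add_mult_p a)
      moreover have "a - int n + ((?f k - v) div int p) * int p = ?f k - int n - int p"
        using f_eq[of k] k(2) by (simp add: algebra_simps)
      ultimately show False using east_label(2) k(1) by (auto simp: E_def)
    qed
    then show "a \<in> (\<lambda>k. v - int p + r k) ` {k \<in> E. ?f k < v}" using k by auto
  qed
  have "inj_on (\<lambda>k. v - int p + r k) {k \<in> E. ?f k < v}"
    using inj by (auto simp: inj_on_def)
  then have "card {k \<in> E. ?f k < v} = card {a. v - int p < a \<and> a < v \<and> a - int n \<in> D}"
    unfolding image[symmetric] by (rule card_image[symmetric])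
  then show ?thesis by (simp add: E_def conj_assoc)
qed

end

end

subsection \<open>Affine permutations\<close>

lemma sum_int_atLeast1: "2 * (\<Sum>i = 1..int m. i) = int m * (int m + 1)"
proof (induction m)
  case (Suc m)
  have "{1..int (Suc m)} = insert (int m + 1) {1..int m}" by auto
  then show ?case using Suc by (simp add: algebra_simps)
qed simp

locale affine_permutation =
  fixes n :: nat and \<omega> :: "int \<Rightarrow> int"
  assumes n_pos: "0 < n" and affine: "\<omega> \<in> affine_perms n"
begin

lemma bij: "bij \<omega>" and add_n: "\<omega> (i + int n) = \<omega> i + int n"
  and sum: "(\<Sum>i = 1..int n. \<omega> i) = int n * (int n + 1) div 2"
  using affine by (auto simp: affine_perms_def)

lemma inv_eq_iff: "inv \<omega> y = z \<longleftrightarrow> \<omega> z = y"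
  using bij by (metis bij_inv_eq_iff)

lemma add_mult_n: "\<omega> (i + k * int n) = \<omega> i + k * int n"
proof (induction k rule: int_induct[of _ 0])
  case (step1 k)
  then show ?case using add_n[of "i + k * int n"] by (simp add: algebra_simps)
next
  case (step2 k)
  then show ?case using add_n[of "i + (k - 1) * int n"] by (simp add: algebra_simps)
qed simp

lemma diff_n: "\<omega> (i - int n) = \<omega> i - int n"
  using add_mult_n[of i "-1"] by simp

text \<open>\<open>\<omega>\<close> permutes the residue classes modulo \<open>n\<close>, hence the normalisation of the sum forces the
  quotients to cancel.\<close>

lemma sum_div: "(\<Sum>i = 1..int n. (\<omega> i - 1) div int n) = 0"
proof -
  define r where "r i = (\<omega> i - 1) mod int n" for i
  have inj: "inj_on r {1..int n}"
  proof (rule inj_onI)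
    fix i j assume ij: "i \<in> {1..int n}" "j \<in> {1..int n}" "r i = r j"
    then have "int n dvd (\<omega> i - 1) - (\<omega> j - 1)" unfolding r_def by (simp only: mod_eq_dvd_iff)
    then obtain t where "\<omega> i = \<omega> j + t * int n" by (auto simp: dvd_def algebra_simps)
    then have "\<omega> i = \<omega> (j + t * int n)" by (simp add: add_mult_n)
    then have eq: "i - j = t * int n" using bij by (simp add: bij_is_inj inj_eq)
    then have "int n dvd i - j" by simp
    then show "i = j"
      using ij(1,2) dvd_imp_le_int[of "i - j" "int n"] unfolding atLeastAtMost_iff by linarith
  qed
  have "r ` {1..int n} = {0..<int n}"
  proof (rule card_subset_eq)
    show "r ` {1..int n} \<subseteq> {0..<int n}" using n_pos by (auto simp: r_def)
  qed (use inj in \<open>auto simp: card_image\<close>)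
  then have "(\<Sum>i = 1..int n. r i) = \<Sum>{0..<int n}" using sum.reindex[OF inj, of id] by simp
  also have "\<dots> = (\<Sum>i = 1..int n. i - 1)"
    by (rule sum.reindex_bij_witness[of _ "\<lambda>i. i - 1" "\<lambda>i. i + 1"]) auto
  finally have r: "(\<Sum>i = 1..int n. r i) = (\<Sum>i = 1..int n. i - 1)" .
  have "(\<Sum>i = 1..int n. \<omega> i - 1) = (\<Sum>i = 1..int n. int n * ((\<omega> i - 1) div int n) + r i)"
    by (simp add: r_def)
  also have "\<dots> = int n * (\<Sum>i = 1..int n. (\<omega> i - 1) div int n) + (\<Sum>i = 1..int n. i - 1)"
    by (simp add: sum.distrib sum_distrib_left r)
  also have "(\<Sum>i = 1..int n. \<omega> i - 1) = (\<Sum>i = 1..int n. i - 1)"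
    using sum sum_int_atLeast1[of n] by (simp add: sum_subtractf)
  finally show ?thesis using n_pos by simp
qed

text \<open>Writing \<open>\<omega> i - 1 = d * n + r\<close> with \<open>0 \<le> r < n\<close>, the
  value at \<open>i + t * n\<close> is \<open>(d + t) * n + r + 1\<close>, whose sign is that of
  \<open>d + t \<ge> 0\<close>.\<close>

lemma nonpos_iff: "\<omega> (i + t * int n) \<le> 0 \<longleftrightarrow> t < - ((\<omega> i - 1) div int n)"
proof -
  define d where "d = (\<omega> i - 1) div int n"
  define r where "r = (\<omega> i - 1) mod int n"
  have r: "0 \<le> r" "r < int n" using n_pos by (auto simp: r_def)
  have "\<omega> i = d * int n + r + 1" using div_mult_mod_eq[of "\<omega> i - 1" "int n"] by (simp add: d_def r_def)
  then have eq: "\<omega> (i + t * int n) = (d + t) * int n + r + 1" by (simp add: add_mult_n algebra_simps)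
  show ?thesis
  proof (cases "d + t < 0")
    case True
    then have "(d + t) * int n \<le> (- 1) * int n" by (intro mult_right_mono) auto
    then show ?thesis using eq r True by (simp add: d_def)
  next
    case False
    then have "0 \<le> (d + t) * int n" by simp
    then have "\<not> \<omega> (i + t * int n) \<le> 0" using eq r by linarith
    then show ?thesis using False by (simp add: d_def)
  qed
qed

lemma ex_window: "\<exists>i \<in> {1..int n}. \<exists>t. z = i + t * int n"
proof (intro bexI exI)
  show "z = ((z - 1) mod int n + 1) + ((z - 1) div int n) * int n"
    using div_mult_mod_eq[of "z - 1" "int n"] by simp
  show "(z - 1) mod int n + 1 \<in> {1..int n}"
    using n_pos pos_mod_bound[of "int n" "z - 1"] pos_mod_sign[of "int n" "z - 1"]
    unfolding atLeastAtMost_iff by linarith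
qed

text \<open>The residue class of \<open>i\<close> contributes \<open>T - d i\<close> elements, where
  \<open>d i\<close> is the quotient from \<open>sum_div\<close>; these quotients add up to
  0.\<close>

lemma card_nonpos:
  assumes T: "\<And>i. i \<in> {1..int n} \<Longrightarrow> (\<omega> i - 1) div int n \<le> int T"
  shows "card {z. - int (n * T) < z \<and> \<omega> z \<le> 0} = n * T"
    "finite {z. - int (n * T) < z \<and> \<omega> z \<le> 0}"
proof -
  define d where "d i = (\<omega> i - 1) div int n" for i
  define S where "S = Sigma {1..int n} (\<lambda>i. {- int T..- d i - 1})"
  define g where "g = (\<lambda>(i, t). i + t * int n)"
  have window: "- int (n * T) < i + t * int n \<longleftrightarrow> - int T \<le> t" if "i \<in> {1..int n}" for i t
  proof (cases "- int T \<le> t")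
    case True
    then have "- int T * int n \<le> t * int n" by (intro mult_right_mono) auto
    then show ?thesis using True that by (simp add: mult.commute)
  next
    case False
    then have "t * int n \<le> (- int T - 1) * int n" by (intro mult_right_mono) auto
    then show ?thesis using False that by (simp add: algebra_simps)
  qed
  have eq: "{z. - int (n * T) < z \<and> \<omega> z \<le> 0} = g ` S"
  proof (rule set_eqI, rule iffI)
    fix z assume z: "z \<in> {z. - int (n * T) < z \<and> \<omega> z \<le> 0}"
    obtain i t where it: "i \<in> {1..int n}" "z = i + t * int n" using ex_window by blast
    then have "(i, t) \<in> S" using z window[of i t] nonpos_iff[of i t] by (auto simp: S_def d_def)
    then show "z \<in> g ` S" using it by (force simp: g_def)
  next
    fix z assume "z \<in> g ` S"
    then obtain i t where "(i, t) \<in> S" "z = i + t * int n" by (auto simp: g_def)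
    then show "z \<in> {z. - int (n * T) < z \<and> \<omega> z \<le> 0}"
      using window[of i t] nonpos_iff[of i t] by (auto simp: S_def d_def)
  qed
  have inj: "inj_on g S"
  proof (rule inj_onI, clarify)
    fix i t j s assume *: "(i, t) \<in> S" "(j, s) \<in> S" "g (i, t) = g (j, s)"
    then have "i - j = (s - t) * int n" by (simp add: g_def algebra_simps)
    then have "int n dvd i - j" by simp
    moreover have "i \<in> {1..int n}" "j \<in> {1..int n}" using * by (auto simp: S_def)
    ultimately have "i = j"
      using dvd_imp_le_int[of "i - j" "int n"] unfolding atLeastAtMost_iff by linarith
    then show "i = j \<and> t = s" using * n_pos by (simp add: g_def)
  qed
  have "int (card (g ` S)) = int (\<Sum>i = 1..int n. card {- int T..- d i - 1})"
    unfolding card_image[OF inj] unfolding S_def by (subst card_SigmaI) auto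
  also have "\<dots> = (\<Sum>i = 1..int n. int T - d i)"
    unfolding of_nat_sum using T by (intro sum.cong) (auto simp: d_def)
  also have "\<dots> = int (n * T)" using sum_div by (simp add: sum_subtractf d_def)
  finally show "card {z. - int (n * T) < z \<and> \<omega> z \<le> 0} = n * T" unfolding eq by linarith
  show "finite {z. - int (n * T) < z \<and> \<omega> z \<le> 0}" unfolding eq S_def by simp
qed

text \<open>Of the \<open>n * T\<close> nonpositive positions above \<open>- n * T\<close>, the
  block below \<open>m\<close> accounts for \<open>m + n * T - 1\<close>, which leaves
  \<open>1 - m\<close> beyond \<open>m\<close>. This number becomes the length of the core.\<close>

lemma ex_least_positive:
  "\<exists>m. 0 < \<omega> m \<and> (\<forall>z < m. \<omega> z \<le> 0) \<and> finite {h. 0 < h \<and> \<omega> (h + m) \<le> 0} \<and>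
    int (card {h. 0 < h \<and> \<omega> (h + m) \<le> 0}) = 1 - m"
proof -
  define d where "d i = (\<omega> i - 1) div int n" for i
  define T where "T = nat (\<Sum>i = 1..int n. \<bar>d i\<bar>)"
  have T: "(\<omega> i - 1) div int n \<le> int T" if "i \<in> {1..int n}" for i
  proof -
    have "\<bar>d i\<bar> \<le> (\<Sum>i = 1..int n. \<bar>d i\<bar>)" using that by (intro member_le_sum) auto
    then show ?thesis by (simp add: T_def d_def)
  qed
  have low: "\<omega> z \<le> 0" if z: "z \<le> - int (n * T)" for z
  proof -
    obtain i t where it: "i \<in> {1..int n}" "z = i + t * int n" using ex_window by blast
    have "t < - int T"
    proof (rule ccontr)
      assume "\<not> t < - int T"
      then have "- int T * int n \<le> t * int n" by (intro mult_right_mono) auto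
      then show False using it z by (simp add: mult.commute)
    qed
    then show ?thesis using nonpos_iff[of i t] T[OF it(1)] it by simp
  qed
  \<comment> \<open>Translation by \<open>n * T\<close> lets \<open>LEAST\<close> search over
    natural numbers; everything at or below \<open>- n * T\<close> is nonpositive.\<close>
  let ?P = "\<lambda>k. 0 < \<omega> (int k - int (n * T))"
  have "\<omega> (inv \<omega> 1) = 1" using inv_eq_iff by blast
  then have "?P (nat (inv \<omega> 1 + int (n * T)))"
    using low[of "inv \<omega> 1"] by (cases "inv \<omega> 1 \<le> - int (n * T)") auto
  then have P: "?P (LEAST k. ?P k)" by (rule LeastI)
  define m where "m = int (LEAST k. ?P k) - int (n * T)"
  have m: "0 < \<omega> m" using P by (simp add: m_def)
  then have m_gt: "- int (n * T) < m" using low[of m] by linarith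
  have below: "\<omega> z \<le> 0" if "z < m" for z
  proof (cases "z \<le> - int (n * T)")
    case False
    define k where "k = nat (z + int (n * T))"
    have k: "z = int k - int (n * T)" using False by (simp add: k_def)
    then have "k < (LEAST k. ?P k)" using that by (simp add: m_def)
    then show ?thesis using not_less_Least[of k ?P] k by simp
  qed (rule low)
  define H where "H = {h. 0 < h \<and> \<omega> (h + m) \<le> 0}"
  let ?S = "{z. - int (n * T) < z \<and> \<omega> z \<le> 0}"
  have S: "?S = {- int (n * T)<..<m} \<union> (\<lambda>h. h + m) ` H"
  proof (rule set_eqI, rule iffI)
    fix z assume z: "z \<in> ?S"
    then have "z \<noteq> m" using m by auto
    then show "z \<in> {- int (n * T)<..<m} \<union> (\<lambda>h. h + m) ` H"
      using z by (cases "z < m") (auto simp: H_def image_iff intro!: exI[of _ "z - m"])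
  next
    fix z assume "z \<in> {- int (n * T)<..<m} \<union> (\<lambda>h. h + m) ` H"
    then show "z \<in> ?S" using below m_gt by (auto simp: H_def)
  qed
  have inj: "inj_on (\<lambda>h. h + m) H" by (simp add: inj_on_def)
  have "finite ((\<lambda>h. h + m) ` H)" using card_nonpos(2)[OF T] unfolding S by simp
  then have fin: "finite H" using finite_imageD inj by blast
  have "n * T = card ({- int (n * T)<..<m} \<union> (\<lambda>h. h + m) ` H)"
    using card_nonpos(1)[OF T] unfolding S by simp
  also have "\<dots> = card {- int (n * T)<..<m} + card ((\<lambda>h. h + m) ` H)"
    by (rule card_Un_disjoint) (use fin in \<open>auto simp: H_def\<close>)
  finally have "int (n * T) = int (card {- int (n * T)<..<m}) + int (card H)"
    by (simp only: card_image[OF inj] of_nat_add)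
  then have "int (card H) = 1 - m" using m_gt by simp
  then show ?thesis using m below fin unfolding H_def by blast
qed

text \<open>The partition is built from the gaps above \<open>m\<close>. Its length is
  \<open>1 - m\<close>, so the translation between hook lengths and beta-set is exactly by
  \<open>m\<close>, and \<open>alpha \<kappa>\<close> agrees with \<open>gamma \<omega>\<close>
  without further shift.\<close>

lemma ex_partition:
  "\<exists>\<kappa> m. is_partition \<kappa> \<and> alpha \<kappa> = gamma \<omega> \<and> 0 < \<omega> m \<and> (\<forall>z < m. \<omega> z \<le> 0) \<and>
    int ` first_column_hooks \<kappa> = {h. 0 < h \<and> \<omega> (h + m) \<le> 0}"
proof -
  obtain m where m: "0 < \<omega> m" "\<And>z. z < m \<Longrightarrow> \<omega> z \<le> 0" "finite {h. 0 < h \<and> \<omega> (h + m) \<le> 0}"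
    "int (card {h. 0 < h \<and> \<omega> (h + m) \<le> 0}) = 1 - m"
    using ex_least_positive by blast
  obtain \<kappa> where \<kappa>: "is_partition \<kappa>" "int ` first_column_hooks \<kappa> = {h. 0 < h \<and> \<omega> (h + m) \<le> 0}"
    using ex_partition_with_hooks[OF m(3)] by blast
  have "card (int ` first_column_hooks \<kappa>) = length \<kappa>"
    using card_first_column_hooks[OF \<kappa>(1)] by (simp add: card_image)
  then have len: "int (length \<kappa>) = 1 - m" using m(4) \<kappa>(2) by simp
  have "alpha \<kappa> = gamma \<omega>"
  proof (rule set_eqI)
    fix z
    consider "z < m" | "z = m" | "m < z" by linarith
    then show "z \<in> alpha \<kappa> \<longleftrightarrow> z \<in> gamma \<omega>"
      unfolding mem_alpha_iff_hooks[OF \<kappa>(1)] \<kappa>(2) gamma_def using len m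
      by cases auto
  qed
  then show ?thesis using \<kappa> m by blast
qed

section \<open>The involution \<open>star\<close>\<close>

lemma star_affine: "affine_permutation n (star \<omega>)"
proof
  have "star \<omega> = (\<lambda>i. 1 - i) \<circ> \<omega> \<circ> (\<lambda>i. 1 - i)" by (auto simp: star_def)
  moreover have "bij (\<lambda>i::int. 1 - i)" by (rule bij_betw_byWitness[of _ "\<lambda>i. 1 - i"]) auto
  ultimately have "bij (star \<omega>)" using bij by (simp add: bij_comp)
  moreover have "star \<omega> (i + int n) = star \<omega> i + int n" for i
    using diff_n[of "1 - i"] by (simp add: star_def algebra_simps)
  moreover have "(\<Sum>i = 1..int n. star \<omega> i) = int n * (int n + 1) div 2"
  proof -
    \<comment> \<open>Periodicity recentres the reflection so that it maps the window from 1 to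
      \<open>n\<close> to itself.\<close>
    have "star \<omega> i = int n + 1 - \<omega> (int n + 1 - i)" for i
      using diff_n[of "int n + 1 - i"] by (simp add: star_def algebra_simps)
    then have "(\<Sum>i = 1..int n. star \<omega> i) = (\<Sum>i = 1..int n. int n + 1 - \<omega> (int n + 1 - i))" by simp
    also have "\<dots> = (\<Sum>i = 1..int n. int n + 1 - \<omega> i)"
      by (rule sum.reindex_bij_witness[of _ "\<lambda>i. int n + 1 - i" "\<lambda>i. int n + 1 - i"]) auto
    also have "\<dots> = int n * (int n + 1) - (\<Sum>i = 1..int n. \<omega> i)" by (simp add: sum_subtractf)
    finally show ?thesis using sum by (simp flip: sum_int_atLeast1)
  qed
  ultimately show "star \<omega> \<in> affine_perms n" by (simp add: affine_perms_def)
qed (rule n_pos)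

lemma gamma_star: "1 - z \<in> gamma (star \<omega>) \<longleftrightarrow> z \<notin> gamma \<omega>"
  by (auto simp: gamma_def star_def)

lemma star_dominant:
  assumes "dominant n \<omega>"
  shows "dominant n (star \<omega>)"
  unfolding dominant_def
proof (rule strict_mono_onI)
  interpret star: affine_permutation n "star \<omega>" by (rule star_affine)
  fix i j assume ij: "i \<in> {1..int n}" "j \<in> {1..int n}" "i < j"
  have inv: "inv (star \<omega>) y = int n + 1 - inv \<omega> (int n + 1 - y)" for y
  proof -
    have "\<omega> (inv \<omega> (int n + 1 - y)) = int n + 1 - y" using inv_eq_iff by blast
    then show ?thesis
      unfolding star.inv_eq_iff star_def
      using diff_n[of "inv \<omega> (int n + 1 - y)"] by (simp add: algebra_simps)
  qed
  have "inv \<omega> (int n + 1 - j) < inv \<omega> (int n + 1 - i)"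
    using assms ij unfolding dominant_def by (auto intro: strict_mono_onD)
  then show "inv (star \<omega>) i < inv (star \<omega>) j" by (simp add: inv)
qed

end

lemma star_p_stable:
  assumes "p_stable p \<omega>"
  shows "p_stable p (star \<omega>)"
  unfolding p_stable_def
proof
  fix i
  have "\<omega> (1 - (i + int p)) < \<omega> (1 - (i + int p) + int p)" using assms unfolding p_stable_def by blast
  then show "star \<omega> i < star \<omega> (i + int p)" by (simp add: star_def)
qed

section \<open>Dominant stable permutations and their Dyck paths\<close>

locale stable_affine_permutation = affine_permutation +
  fixes p :: nat
  assumes p_pos: "0 < p" and coprime: "coprime n p"
    and dominant: "dominant n \<omega>" and stable: "p_stable p \<omega>"
begin

lemma star_stable: "stable_affine_permutation n (star \<omega>) p"
  by (rule stable_affine_permutation.intro[OF star_affine], unfold_locales)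
    (use p_pos coprime star_dominant[OF dominant] star_p_stable[OF stable] in auto)

lemma diff_p: "\<omega> (z - int p) < \<omega> z"
  using stable unfolding p_stable_def by (metis diff_add_cancel)

text \<open>Periodicity and stability make \<open>gamma \<omega>\<close> closed under subtracting
  \<open>n\<close> and \<open>p\<close>, so a partition with this beta-set is a core for both;
  \<open>alpha_inject\<close> gives uniqueness.\<close>

lemma the_core_eq:
  assumes "is_partition \<kappa>" and eq: "alpha \<kappa> = gamma \<omega>"
  shows "(THE \<kappa>. \<kappa> \<in> cores n p \<and> alpha \<kappa> = gamma \<omega>) = \<kappa>"
proof (rule the_equality)
  have "is_core n \<kappa>"
    using assms diff_n by (intro is_core_if_alpha_closed) (auto simp: gamma_def)
  moreover have "is_core p \<kappa>"
    using assms order.trans[OF less_imp_le[OF diff_p]]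
    by (intro is_core_if_alpha_closed) (auto simp: gamma_def)
  ultimately show "\<kappa> \<in> cores n p \<and> alpha \<kappa> = gamma \<omega>" using eq by (simp add: cores_def)
  show "\<mu> = \<kappa>" if "\<mu> \<in> cores n p \<and> alpha \<mu> = gamma \<omega>" for \<mu>
    using that assms alpha_inject by (auto simp: cores_def is_core_def)
qed

lemma semimodule_positive:
  assumes "0 < \<omega> m" "\<And>z. z < m \<Longrightarrow> \<omega> z \<le> 0"
  shows "semimodule n p {z. 0 < \<omega> (z + m)}"
proof
  fix z assume z: "z \<in> {z. 0 < \<omega> (z + m)}"
  show "0 \<le> z" using assms(2)[of "z + m"] z by force
  show "z + int n \<in> {z. 0 < \<omega> (z + m)}" using z add_n[of "z + m"] by (simp add: algebra_simps)
  show "z + int p \<in> {z. 0 < \<omega> (z + m)}" using z diff_p[of "z + int p + m"] by (simp add: algebra_simps)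
qed (use n_pos p_pos coprime assms in auto)

text \<open>\<open>ex_dyck_path\<close> shows that \<open>\<kappa>\<close> is in the image of
  \<open>phi\<close>, hence the chosen preimage really is a Dyck path mapped to
  \<open>\<kappa>\<close>.\<close>

lemma anderson_path:
  assumes \<kappa>: "is_partition \<kappa>" "alpha \<kappa> = gamma \<omega>"
  shows "anderson n p \<omega> = phi_inv n p \<kappa>" "anderson n p \<omega> \<in> dyck_paths n p"
    "phi n p (anderson n p \<omega>) = \<kappa>"
proof -
  obtain \<mu> m where \<mu>: "is_partition \<mu>" "alpha \<mu> = gamma \<omega>" "0 < \<omega> m" "\<And>z. z < m \<Longrightarrow> \<omega> z \<le> 0"
    "int ` first_column_hooks \<mu> = {h. 0 < h \<and> \<omega> (h + m) \<le> 0}"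
    using ex_partition by blast
  have "\<mu> = \<kappa>" using alpha_inject \<mu> \<kappa> by metis
  interpret semimodule n p "{z. 0 < \<omega> (z + m)}" by (rule semimodule_positive[OF \<mu>(3,4)])
  obtain x where "x \<in> dyck_paths n p" "pos_labels n p x = {h. 0 < h \<and> h \<notin> {z. 0 < \<omega> (z + m)}}"
    using ex_dyck_path by blast
  then have "phi n p x = \<kappa>" using \<mu> \<open>\<mu> = \<kappa>\<close> by (intro phi_eqI) (auto simp: not_less)
  then have "\<kappa> \<in> phi n p ` dyck_paths n p" using \<open>x \<in> dyck_paths n p\<close> by blast
  moreover show "anderson n p \<omega> = phi_inv n p \<kappa>"
    unfolding anderson_def the_core_eq[OF \<kappa>] ..
  ultimately show "anderson n p \<omega> \<in> dyck_paths n p" "phi n p (anderson n p \<omega>) = \<kappa>"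
    unfolding phi_inv_def by (auto intro: inv_into_into f_inv_into_f)
qed

text \<open>Translating both entries of an inversion by the same multiple of \<open>n\<close>
  preserves it. The definition normalises pairs by \<open>a \<in> {1..n}\<close>; here they are
  normalised by \<open>\<omega> b = k\<close>, that is \<open>b = u\<close>.\<close>

lemma pak_stanley_eq:
  assumes u: "u = inv \<omega> (int k)"
  shows "pak_stanley n p \<omega> k = card {a. u - int p < a \<and> a < u \<and> int k < \<omega> a}"
proof -
  \<comment> \<open>The unique multiplier for which \<open>a + t a * n\<close> lies in the window
    from 1 to \<open>n\<close>.\<close>
  define t where "t a = - ((a - 1) div int n)" for a
  define g where "g a = (a + t a * int n, u + t a * int n)" for a
  have \<omega>u: "\<omega> u = int k" using u inv_eq_iff by blast
  have t: "a + t a * int n \<in> {1..int n}" for a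
    using div_mult_mod_eq[of "a - 1" "int n"] n_pos pos_mod_bound[of "int n" "a - 1"]
      pos_mod_sign[of "int n" "a - 1"]
    unfolding t_def atLeastAtMost_iff mult_minus_left by linarith
  have t_unique: "s = t a" if "a + s * int n \<in> {1..int n}" for a s
  proof -
    have "(a - 1 + s * int n) div int n = 0" using that by (intro div_pos_pos_trivial) auto
    then show ?thesis using n_pos by (simp add: t_def)
  qed
  have "{(a, b). a \<in> {1..int n} \<and> b \<in> \<nat> \<and> a < b \<and> b < a + int p \<and> \<omega> a > \<omega> b \<and>
      [\<omega> b = int k] (mod int n)} = g ` {a. u - int p < a \<and> a < u \<and> int k < \<omega> a}" (is "?L = g ` ?R")
  proof (rule set_eqI, rule iffI)
    fix z assume "z \<in> ?L"
    then obtain a b where z: "z = (a, b)" and ab: "a \<in> {1..int n}" "a < b" "b < a + int p"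
      "\<omega> b < \<omega> a" "[\<omega> b = int k] (mod int n)" by blast
    obtain s where "\<omega> b = int k + s * int n"
      using ab(5) by (metis add.commute cong_iff_lin cong_sym mult.commute)
    then have "\<omega> b = \<omega> (u + s * int n)" by (simp add: add_mult_n \<omega>u)
    then have b: "b = u + s * int n" using bij by (simp add: bij_is_inj inj_eq)
    define a' where "a' = a - s * int n"
    have a: "a = a' + s * int n" by (simp add: a'_def)
    then have "s = t a'" using ab(1) t_unique by simp
    then have "z = g a'" unfolding z g_def a b by simp
    moreover have "a' \<in> ?R" using ab unfolding a b by (simp add: add_mult_n \<omega>u)
    ultimately show "z \<in> g ` ?R" by blast
  next
    fix z assume "z \<in> g ` ?R"
    then obtain a where a: "u - int p < a" "a < u" "int k < \<omega> a" "z = g a" by blast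
    have "0 \<le> u + t a * int n" using t[of a] a by auto
    then have "u + t a * int n \<in> \<nat>" by (metis of_nat_in_Nats nonneg_int_cases)
    then show "z \<in> ?L" using t[of a] a unfolding a(4) g_def
      by (simp add: add_mult_n \<omega>u cong_def)
  qed
  moreover have "inj_on g ?R"
    using n_pos by (auto intro!: inj_onI simp: g_def)
  ultimately show ?thesis unfolding pak_stanley_def by (simp add: card_image)
qed

lemma easts_before_zeta_anderson:
  assumes k: "1 \<le> k" "k \<le> n"
  shows "easts_before (zeta n p (anderson n p \<omega>)) k = pak_stanley n p \<omega> k"
proof -
  obtain \<kappa> m where \<kappa>: "is_partition \<kappa>" "alpha \<kappa> = gamma \<omega>" "0 < \<omega> m" "\<And>z. z < m \<Longrightarrow> \<omega> z \<le> 0"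
    "int ` first_column_hooks \<kappa> = {h. 0 < h \<and> \<omega> (h + m) \<le> 0}"
    using ex_partition by blast
  define D where "D = {z. 0 < \<omega> (z + m)}"
  interpret semimodule n p D unfolding D_def by (rule semimodule_positive[OF \<kappa>(3,4)])
  define x where "x = anderson n p \<omega>"
  have x: "x \<in> dyck_paths n p" "phi n p x = \<kappa>"
    using anderson_path[OF \<kappa>(1,2)] by (simp_all add: x_def)
  have pos: "pos_labels n p x = {h. 0 < h \<and> h \<notin> D}"
    using phi_hooks[of n p x] x(2) \<kappa>(5) by (auto simp: D_def not_less)
  let ?f = "step_label n p x"
  define N where "N = {k. k < length x \<and> x ! k = North}"
  \<comment> \<open>The value of \<open>\<omega>\<close> at the label translated back by
    \<open>m\<close>. For North steps it runs bijectively through 1 to \<open>n\<close>, and by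
    dominance it increases with the label.\<close>
  define g where "g q = \<omega> (?f q + m)" for q
  have g_range: "g q \<in> {1..int n}" if "q \<in> N" for q
    using north_label[OF x(1) pos, of q] that diff_n[of "?f q + m"]
    by (auto simp: N_def D_def g_def algebra_simps)
  have f_eq: "?f q = inv \<omega> (g q) - m" for q
    using inv_eq_iff[of "g q" "?f q + m"] by (simp add: g_def)
  have inv_less: "inv \<omega> i < inv \<omega> j \<longleftrightarrow> i < j" if "i \<in> {1..int n}" "j \<in> {1..int n}" for i j
    using dominant that unfolding dominant_def by (rule strict_mono_on_less)
  have f_less: "?f q < ?f q' \<longleftrightarrow> g q < g q'" if "q \<in> N" "q' \<in> N" for q q'
    using inv_less[OF g_range[OF that(1)] g_range[OF that(2)]] by (simp add: f_eq)
  have inj: "inj_on g N"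
  proof (rule inj_onI)
    fix q q' assume "q \<in> N" "q' \<in> N" "g q = g q'"
    then show "q = q'" using inj_step_label[OF x(1) pos] f_eq[of q] f_eq[of q']
      by (auto simp: N_def inj_on_def)
  qed
  have image: "g ` N = {1..int n}"
  proof (rule card_subset_eq)
    have "card N = n" using card_steps[of x North] counts[OF x(1) pos] by (simp add: N_def)
    then show "card (g ` N) = card {1..int n}" using inj by (simp add: card_image)
  qed (use g_range in auto)
  moreover have "int k \<in> {1..int n}" using k by simp
  ultimately obtain q where q: "q \<in> N" "g q = int k" by (metis imageE)
  have "g ` {q' \<in> N. ?f q' < ?f q} = {1..<int k}"
  proof (rule set_eqI, rule iffI)
    fix i assume "i \<in> g ` {q' \<in> N. ?f q' < ?f q}"
    then show "i \<in> {1..<int k}" using f_less q g_range by force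
  next
    fix i assume i: "i \<in> {1..<int k}"
    then have "i \<in> g ` N" unfolding image using k by auto
    then show "i \<in> g ` {q' \<in> N. ?f q' < ?f q}" using f_less q i by auto
  qed
  moreover have "inj_on g {q' \<in> N. ?f q' < ?f q}" using inj by (rule inj_on_subset) auto
  ultimately have "card {q' \<in> N. ?f q' < ?f q} = k - 1"
    by (metis card_atLeastLessThan_int card_image nat_int of_nat_1 of_nat_diff k(1))
  then have north: "card {k. k < length x \<and> x ! k = North \<and> ?f k < ?f q} = k - 1"
    by (simp add: N_def conj_assoc)
  define u where "u = inv \<omega> (int k)"
  have u: "?f q = u - m" using f_eq[of q] q by (simp add: u_def)
  have q': "q < length x" "x ! q = North" using q by (auto simp: N_def)
  have "easts_before (zeta n p x) (Suc (k - 1)) =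
    card {k. k < length x \<and> x ! k = East \<and> ?f k < ?f q}"
    by (rule easts_before_zeta[OF inj_step_label[OF x(1) pos] q' north])
  also have "\<dots> = card {a. ?f q - int p < a \<and> a < ?f q \<and> a - int n \<in> D}"
    by (rule card_east_labels_below[OF x(1) pos north_label(2)[OF x(1) pos q']])
  also have "\<dots> = card {a. u - int p < a \<and> a < u \<and> int k < \<omega> a}"
  proof (rule bij_betw_same_card[of "\<lambda>a. a + m"])
    \<comment> \<open>A value strictly above \<open>k\<close> and at most \<open>n\<close> would, by
      dominance, be attained to the right of \<open>u\<close>.\<close>
    have "int k < \<omega> a \<longleftrightarrow> int n < \<omega> a" if "a < u" for a
    proof
      assume "int k < \<omega> a"
      moreover have "inv \<omega> (\<omega> a) = a" using inv_eq_iff by blast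
      ultimately show "int n < \<omega> a"
        using inv_less[of "int k" "\<omega> a"] that k by (force simp: u_def)
    qed (use k in simp)
    moreover have "a - int n \<in> D \<longleftrightarrow> int n < \<omega> (a + m)" for a
      using diff_n[of "a + m"] by (simp add: D_def add_diff_eq diff_add_eq)
    ultimately show "bij_betw (\<lambda>a. a + m) {a. ?f q - int p < a \<and> a < ?f q \<and> a - int n \<in> D}
        {a. u - int p < a \<and> a < u \<and> int k < \<omega> a}"
      unfolding u by (intro bij_betw_byWitness[of _ "\<lambda>a. a - m"]) auto
  qed
  also have "\<dots> = pak_stanley n p \<omega> k" by (rule pak_stanley_eq[OF u_def, symmetric])
  finally show ?thesis using k by (simp add: x_def)
qed

lemma path_complement_zeta_anderson:
  "path_complement n (zeta n p (anderson n p \<omega>)) =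
    map (\<lambda>j. pak_stanley n p \<omega> (n + 1 - j)) [1..<n + 1]"
  unfolding path_complement_def
  by (rule map_cong[OF refl]) (auto intro!: easts_before_zeta_anderson)

text \<open>Conjugation and \<open>star\<close> reflect the beta-set in the same way, so the
  conjugate core of \<open>\<omega>\<close> is the core of \<open>star \<omega>\<close>. This
  reduces the claim on \<open>eta\<close> to the one on \<open>zeta\<close>.\<close>

lemma eta_anderson: "eta n p (anderson n p \<omega>) = zeta n p (anderson n p (star \<omega>))"
proof -
  interpret star: stable_affine_permutation n "star \<omega>" p by (rule star_stable)
  obtain \<kappa> where \<kappa>: "is_partition \<kappa>" "alpha \<kappa> = gamma \<omega>" using ex_partition by blast
  have "alpha (conjugate \<kappa>) = gamma (star \<omega>)"
  proof (rule set_eqI)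
    show "z \<in> alpha (conjugate \<kappa>) \<longleftrightarrow> z \<in> gamma (star \<omega>)" for z
      using alpha_conjugate_compl[OF \<kappa>(1), of "1 - z"] gamma_star[of "1 - z"] \<kappa>(2) by simp
  qed
  then have "anderson n p (star \<omega>) = phi_inv n p (conjugate \<kappa>)"
    using star.anderson_path(1) is_partition_conjugate[OF \<kappa>(1)] by blast
  then show ?thesis using anderson_path(3)[OF \<kappa>] by (simp add: eta_def)
qed

end

theorem theorem3p4:
  fixes n p :: nat and \<omega> :: "int \<Rightarrow> int"
  assumes "0 < n" and "0 < p" and "coprime n p"
    and "\<omega> \<in> affine_perms n" and "dominant n \<omega>" and "p_stable p \<omega>"
  shows "path_complement n (zeta n p (anderson n p \<omega>)) =
           map (\<lambda>j. pak_stanley n p \<omega> (n + 1 - j)) [1..<n + 1]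
         \<and> path_complement n (eta n p (anderson n p \<omega>)) =
           map (\<lambda>j. dual_pak_stanley n p \<omega> (n + 1 - j)) [1..<n + 1]"
proof -
  interpret stable_affine_permutation n \<omega> p using assms by unfold_locales
  interpret star: stable_affine_permutation n "star \<omega>" p by (rule star_stable)
  show ?thesis
    using path_complement_zeta_anderson star.path_complement_zeta_anderson
    by (simp add: eta_anderson dual_pak_stanley_def)
qed

end
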